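(* Let $a\ge2$ be an integer, $H=\langle a,a+1\rangle$, $k$ a field, $A=k[[H]]=k[[t^a,t^{a+1}]]\subseteq k[[t]]$, and $\mathfrak m=(t^a,t^{a+1})$ the maximal ideal of $A$. Let $q=a-1$, let $s\in H$ with $0<s<aq$, and put $Q=(t^s)$ and $I=Q:\mathfrak m^q$. Write $s=a\ell+r$ with integers $1\le\ell<q$ and $0\le r<a$, and assume that $r=\ell-1$. If $\ell\ge2$ and $a\ge\ell+3$, then $Q\cap I^{a-\ell}\ne QI^{(a-\ell)-1}$. Hence $\mathrm G(I)$ is not a Cohen-Macaulay ring and $\mathrm r_Q(I)=a-\ell$.
   Context: $\langle a,a+1\rangle=\{\alpha a+\beta(a+1)\mid 0\le\alpha,\beta\in\mathbb Z\}$. $k[[t]]$ is the formal power series ring in an indeterminate $t$; $Q:\mathfrak m^q=\{x\in A\mid\mathfrak m^qx\subseteq Q\}$. $\mathrm G(I)=\bigoplus_{n\ge0}I^n/I^{n+1}$ is the associated graded ring, and $\mathrm r_Q(I)=\min\{0\le n\in\mathbb Z\mid I^{n+1}=QI^n\}$ is the reduction number of $I$ with respect to $Q$. The conclusions about $\mathrm G(I)$ and $\mathrm r_Q(I)$ are asserted for $q=a-1$ and $s=a\ell+r$ with $1\le\ell<q$ and $r=\ell-1$, assuming $\ell\ge2$ and $a\ge\ell+3$. *)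

theory Defs
  imports "HOL-Computational_Algebra.Formal_Power_Series" "HOL-Library.Extended_Nat"
    "HOL-Algebra.Algebra" "HOL-Algebra.Algebraic_Closure_Type"
begin

section \<open>Colon ideals and reduction numbers\<close>

definition colon_ideal :: "('a, 'b) ring_scheme \<Rightarrow> 'a set \<Rightarrow> 'a set \<Rightarrow> 'a set" where
  "colon_ideal R J K = {x \<in> carrier R. \<forall>y\<in>K. x \<otimes>\<^bsub>R\<^esub> y \<in> J}"

text \<open>
  The power \<open>J\<^sup>n\<close> of an ideal is the power in the monoid \<^const>\<open>ideals_set\<close> of all ideals under
  the ideal product; in particular the zeroth power is the whole ring.
\<close>

abbreviation ideal_pow :: "('a, 'b) ring_scheme \<Rightarrow> 'a set \<Rightarrow> nat \<Rightarrow> 'a set" where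
  "ideal_pow R J n \<equiv> J [^]\<^bsub>ideals_set R\<^esub> n"

text \<open>The infimum is \<open>\<infinity>\<close> if no such \<open>n\<close> exists; otherwise it is the minimum.\<close>

definition reduction_number :: "('a, 'b) ring_scheme \<Rightarrow> 'a set \<Rightarrow> 'a set \<Rightarrow> enat" where
  "reduction_number R Q J =
     Inf {enat n | n. ideal_pow R J (n + 1) = Q \<cdot>\<^bsub>R\<^esub> ideal_pow R J n}"


section \<open>The associated graded ring\<close>

text \<open>
  An element of the direct sum of the \<open>J\<^sup>n / J\<^sup>n\<^sup>+\<^sup>1\<close> is a finitely supported family of cosets, the
  \<open>n\<close>-th one being a coset modulo \<open>J\<^sup>n\<^sup>+\<^sup>1\<close> of an element of \<open>J\<^sup>n\<close>.  The \<open>n\<close>-th component of a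
  product is the sum over \<open>i \<le> n\<close> of the products \<open>J\<^sup>i/J\<^sup>i\<^sup>+\<^sup>1 \<times> J\<^sup>n\<^sup>-\<^sup>i/J\<^sup>n\<^sup>-\<^sup>i\<^sup>+\<^sup>1 \<rightarrow> J\<^sup>n/J\<^sup>n\<^sup>+\<^sup>1\<close>,
  \<open>(x + J\<^sup>i\<^sup>+\<^sup>1, y + J\<^sup>n\<^sup>-\<^sup>i\<^sup>+\<^sup>1) \<mapsto> xy + J\<^sup>n\<^sup>+\<^sup>1\<close>, computed inside the quotient ring by \<open>J\<^sup>n\<^sup>+\<^sup>1\<close>.
\<close>

definition assoc_graded :: "('a, 'b) ring_scheme \<Rightarrow> 'a set \<Rightarrow> (nat \<Rightarrow> 'a set) ring" where
  "assoc_graded R J =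
    \<lparr>carrier = {g. (\<forall>n. g n \<in> (\<lambda>x. ideal_pow R J (Suc n) +>\<^bsub>R\<^esub> x) ` ideal_pow R J n)
                  \<and> finite {n. g n \<noteq> ideal_pow R J (Suc n)}},
     monoid.mult = (\<lambda>g h n. \<Oplus>\<^bsub>R Quot ideal_pow R J (Suc n)\<^esub> i \<in> {..n}.
               rcoset_mult R (ideal_pow R J (Suc n)) (g i) (h (n - i))),
     one = (\<lambda>n. if n = 0 then ideal_pow R J (Suc 0) +>\<^bsub>R\<^esub> \<one>\<^bsub>R\<^esub> else ideal_pow R J (Suc n)),
     ring.zero = (\<lambda>n. ideal_pow R J (Suc n)),
     add = (\<lambda>g h n. g n <+>\<^bsub>R\<^esub> h n)\<rparr>"


lemma (in cring) ideal_pow_is_ideal: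
  assumes "ideal J R" shows "ideal (ideal_pow R J n) R"
proof -
  interpret M: comm_monoid "ideals_set R" by (rule ideals_set_is_comm_monoid)
  have "J \<in> carrier (ideals_set R)" using assms by (simp add: ideals_set_def)
  from M.nat_pow_closed[OF this] show ?thesis by (simp add: ideals_set_def)
qed

lemma (in cring) ideal_pow_mult:
  assumes "ideal J R" "x \<in> ideal_pow R J i" "y \<in> ideal_pow R J j"
  shows "x \<otimes> y \<in> ideal_pow R J (i + j)"
proof -
  interpret M: comm_monoid "ideals_set R" by (rule ideals_set_is_comm_monoid)
  have "J \<in> carrier (ideals_set R)" using assms(1) by (simp add: ideals_set_def)
  from M.nat_pow_mult[OF this, of i j]
  have "ideal_pow R J (i + j) = ideal_pow R J i \<cdot> ideal_pow R J j"
    by (simp add: ideals_set_def)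
  then show ?thesis using assms by (auto intro: ideal_prod.prod)
qed

lemma (in cring) ideal_pow_Suc_subset:
  assumes "ideal J R" shows "ideal_pow R J (Suc n) \<subseteq> ideal_pow R J n"
proof -
  have "ideal_pow R J (Suc n) = ideal_pow R J n \<cdot> J"
    by (simp add: ideals_set_def)
  then show ?thesis
    using ideal_prod_inter[OF ideal_pow_is_ideal[OF assms] assms] by auto
qed

text \<open>
  The associated graded ring is the image of the Rees algebra (a subring of the polynomial ring
  over \<open>R\<close>) under taking residue classes componentwise.
\<close>

lemma (in cring) cring_assoc_graded:
  assumes J: "ideal J R"
  shows "cring (assoc_graded R J)"
proof -
  note Group.nat_pow_Suc [simp del]
  let ?P = "\<lambda>n. ideal_pow R J n"
  let ?G = "assoc_graded R J"
  have id: "ideal (?P n) R" for n by (rule ideal_pow_is_ideal[OF J])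
  define S where "S = {p \<in> up R. \<forall>n. p n \<in> ?P n}"
  define h where "h = (\<lambda>p n. ?P (Suc n) +> p n)"
  interpret U: cring "UP R"
    by (rule UP_cring.UP_cring) (simp add: UP_cring_def cring_axioms)
  have coset_zero: "?P n +> x = ?P n" if "x \<in> ?P n" for n x
    using ideal.axioms(1)[OF id] that
    by (meson abelian_subgroup.a_rcos_const abelian_subgroupI3 is_abelian_group)
  have hom: "(\<lambda>x. ?P n +> x) \<in> ring_hom R (R Quot ?P n)" for n
    by (rule ideal.rcos_ring_hom[OF id])
  have UPsel: "carrier (UP R) = up R" "\<one>\<^bsub>UP R\<^esub> = (\<lambda>i. if i = 0 then \<one> else \<zero>)" "\<zero>\<^bsub>UP R\<^esub> = (\<lambda>i. \<zero>)"
    by (simp_all add: UP_def)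
  have UPmult: "p \<otimes>\<^bsub>UP R\<^esub> q = (\<lambda>n. \<Oplus>i\<in>{..n}. p i \<otimes> q (n - i))"
    and UPadd: "p \<oplus>\<^bsub>UP R\<^esub> q = (\<lambda>i. p i \<oplus> q i)" if "p \<in> up R" "q \<in> up R" for p q
    unfolding UP_def by (simp_all only: that ring.simps monoid.simps restrict_apply' if_True refl)
  have Scarr: "p n \<in> carrier R" if "p \<in> S" for p n using that unfolding S_def by blast
  have fin: "(\<Oplus>i\<in>{..n}. f i) \<in> ?P m" if "\<And>i. i \<le> n \<Longrightarrow> f i \<in> ?P m" for f and n m :: nat
    using that
  proof (induction n)
    case 0
    then show ?case using ideal.Icarr[OF id] by simp
  next
    case (Suc n)
    have "f \<in> {..Suc n} \<rightarrow> carrier R" using Suc.prems ideal.Icarr[OF id] by auto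
    then show ?case
      using Suc additive_subgroup.a_closed[OF ideal.axioms(1)[OF id]] by simp
  qed
  have neg: "\<ominus>\<^bsub>UP R\<^esub> p = (\<lambda>i. \<ominus> p i)" if p: "p \<in> up R" for p
  proof (rule U.minus_equality)
    show "(\<lambda>i. \<ominus> p i) \<oplus>\<^bsub>UP R\<^esub> p = \<zero>\<^bsub>UP R\<^esub>"
      unfolding UPadd[OF up_a_inv_closed[OF p] p] UPsel
      by (rule ext) (rule l_neg[OF mem_upD[OF p]])
  qed (simp_all only: UPsel p up_a_inv_closed)
  have "subring S (UP R)"
  proof (rule U.subringI)
    show "S \<subseteq> carrier (UP R)" by (auto simp: S_def UP_def)
    show "\<one>\<^bsub>UP R\<^esub> \<in> S"
    proof -
      have "\<one> \<in> ?P 0" by (simp add: ideals_set_def)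
      moreover have "\<zero> \<in> ?P n" for n
        by (rule additive_subgroup.zero_closed[OF ideal.axioms(1)[OF id]])
      ultimately show ?thesis
        unfolding S_def UPsel(2) using up_one_closed by (simp only: mem_Collect_eq) presburger
    qed
    fix p assume p: "p \<in> S"
    then have pu: "p \<in> up R" and pP: "p n \<in> ?P n" for n by (simp_all only: S_def mem_Collect_eq)
    show "\<ominus>\<^bsub>UP R\<^esub> p \<in> S"
      unfolding neg[OF pu] S_def
      using up_a_inv_closed[OF pu] additive_subgroup.a_inv_closed[OF ideal.axioms(1)[OF id] pP]
      by (simp only: mem_Collect_eq) blast
    fix q assume q: "q \<in> S"
    then have qu: "q \<in> up R" and qP: "q n \<in> ?P n" for n by (simp_all only: S_def mem_Collect_eq)
    show "p \<oplus>\<^bsub>UP R\<^esub> q \<in> S"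
      unfolding UPadd[OF pu qu] S_def
      using up_add_closed[OF pu qu] additive_subgroup.a_closed[OF ideal.axioms(1)[OF id] pP qP]
      by (simp only: mem_Collect_eq) blast
    have "(\<Oplus>i\<in>{..n}. p i \<otimes> q (n - i)) \<in> ?P n" for n
    proof (rule fin)
      fix i assume "i \<le> n"
      then show "p i \<otimes> q (n - i) \<in> ?P n"
        using ideal_pow_mult[OF J pP[of i] qP[of "n - i"]] by simp
    qed
    then show "p \<otimes>\<^bsub>UP R\<^esub> q \<in> S"
      unfolding UPmult[OF pu qu] S_def
      using up_mult_closed[OF pu qu] by (simp only: mem_Collect_eq) blast
  qed
  then have "subcring S (UP R)" by (rule U.subcringI')
  then interpret S: cring "(UP R)\<lparr>carrier := S\<rparr>"
    using U.subcring_iff[of S] by (simp add: S_def UPsel(1))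
  have hS: "h ` S = carrier ?G"
  proof
    show "h ` S \<subseteq> carrier ?G"
    proof clarify
      fix p assume p: "p \<in> S"
      then obtain N where N: "bound \<zero> N p" by (auto simp: S_def up_def)
      have "h p n = ?P (Suc n)" if "n > N" for n
        using bound.bound[OF N that] coset_zero additive_subgroup.zero_closed[OF ideal.axioms(1)[OF id]]
        by (simp only: h_def)
      then have "{n. h p n \<noteq> ?P (Suc n)} \<subseteq> {..N}" using linorder_not_le by blast
      then have "finite {n. h p n \<noteq> ?P (Suc n)}" by (rule finite_subset) simp
      moreover have "h p n \<in> (\<lambda>x. ?P (Suc n) +> x) ` ?P n" for n
        using p unfolding h_def S_def by blast
      ultimately show "h p \<in> carrier ?G"
        unfolding assoc_graded_def partial_object.simps by blast
    qed
    show "carrier ?G \<subseteq> h ` S"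
    proof
      fix g assume g: "g \<in> carrier ?G"
      have "\<forall>n. \<exists>x. x \<in> ?P n \<and> g n = ?P (Suc n) +> x"
        using g unfolding assoc_graded_def partial_object.simps by blast
      then obtain x where x: "\<And>n. x n \<in> ?P n" "\<And>n. g n = ?P (Suc n) +> x n" by metis
      define p where "p = (\<lambda>n. if g n = ?P (Suc n) then \<zero> else x n)"
      have z: "\<zero> \<in> ?P n" for n
        by (rule additive_subgroup.zero_closed[OF ideal.axioms(1)[OF id]])
      have "finite {n. g n \<noteq> ?P (Suc n)}" 
        using g unfolding assoc_graded_def partial_object.simps by blast
      then obtain N where "\<And>n. g n \<noteq> ?P (Suc n) \<Longrightarrow> n \<le> N"
        unfolding finite_nat_set_iff_bounded_le by blast
      then have "bound \<zero> N p" unfolding p_def by (intro bound.intro) (meson linorder_not_le)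
      moreover have pP: "p n \<in> ?P n" for n
        unfolding p_def by (cases "g n = ?P (Suc n)") (simp_all only: refl if_True if_False z x(1))
      ultimately have "p \<in> up R" using ideal.Icarr[OF id pP] by (intro mem_upI) blast+
      then have "p \<in> S" using pP unfolding S_def by blast
      moreover have "h p n = g n" for n
        unfolding h_def p_def
        by (cases "g n = ?P (Suc n)") (simp_all only: refl if_True if_False coset_zero[OF z] x(2)[symmetric])
      then have "h p = g" by (rule ext)
      ultimately show "g \<in> h ` S" by blast
    qed
  qed
  have hmult: "h (p \<otimes>\<^bsub>UP R\<^esub> q) = h p \<otimes>\<^bsub>?G\<^esub> h q" if p: "p \<in> S" and q: "q \<in> S" for p q
  proof
    fix n
    have c: "p i \<in> carrier R" "q i \<in> carrier R" for i using p q Scarr by auto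
    have up: "p \<in> up R" "q \<in> up R" using p q by (auto simp: S_def)
    have eq: "rcoset_mult R (?P (Suc n)) (h p i) (h q (n - i)) = ?P (Suc n) +> (p i \<otimes> q (n - i))"
      if "i \<le> n" for i
    proof (intro equalityI subsetI)
      fix z
      { assume "z \<in> rcoset_mult R (?P (Suc n)) (h p i) (h q (n - i))"
        then obtain u v where uv: "u \<in> ?P (Suc i)" "v \<in> ?P (Suc (n - i))"
          "z \<in> ?P (Suc n) +> ((u \<oplus> p i) \<otimes> (v \<oplus> q (n - i)))"
          by (auto simp: rcoset_mult_def h_def a_r_coset_def')
        have cu: "u \<in> carrier R" "v \<in> carrier R" using uv ideal.Icarr[OF id] by blast+
        have pP: "p m \<in> ?P m" and qP: "q m \<in> ?P m" for m
          using p q unfolding S_def by blast+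
        have "v \<in> ?P (n - i)" using uv(2) ideal_pow_Suc_subset[OF J, of "n - i"] by blast
        then have "v \<oplus> q (n - i) \<in> ?P (n - i)"
          by (rule additive_subgroup.a_closed[OF ideal.axioms(1)[OF id]]) (rule qP)
        from ideal_pow_mult[OF J uv(1) this]
        have "u \<otimes> (v \<oplus> q (n - i)) \<in> ?P (Suc n)" using \<open>i \<le> n\<close> by simp
        moreover from ideal_pow_mult[OF J pP[of i] uv(2)]
        have "p i \<otimes> v \<in> ?P (Suc n)" using \<open>i \<le> n\<close> by simp
        ultimately have w: "u \<otimes> (v \<oplus> q (n - i)) \<oplus> p i \<otimes> v \<in> ?P (Suc n)"
          by (rule additive_subgroup.a_closed[OF ideal.axioms(1)[OF id]])
        obtain t where t: "t \<in> ?P (Suc n)" "z = t \<oplus> ((u \<oplus> p i) \<otimes> (v \<oplus> q (n - i)))"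
          using uv(3) by (auto simp: a_r_coset_def')
        have tc: "t \<in> carrier R" using t ideal.Icarr[OF id] by blast
        have "z = (t \<oplus> (u \<otimes> (v \<oplus> q (n - i)) \<oplus> p i \<otimes> v)) \<oplus> p i \<otimes> q (n - i)"
          using t(2) tc cu c by algebra
        moreover have "t \<oplus> (u \<otimes> (v \<oplus> q (n - i)) \<oplus> p i \<otimes> v) \<in> ?P (Suc n)"
          by (rule additive_subgroup.a_closed[OF ideal.axioms(1)[OF id] t(1) w])
        ultimately show "z \<in> ?P (Suc n) +> (p i \<otimes> q (n - i))"
          by (auto simp: a_r_coset_def') }
      { assume z: "z \<in> ?P (Suc n) +> (p i \<otimes> q (n - i))"
        have "p i \<in> h p i" "q (n - i) \<in> h q (n - i)"
          using abelian_subgroup.a_rcos_self[OF abelian_subgroupI3[OF ideal.axioms(1)[OF id] is_abelian_group]] c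
          by (simp_all add: h_def)
        then show "z \<in> rcoset_mult R (?P (Suc n)) (h p i) (h q (n - i))"
          using z by (auto simp: rcoset_mult_def) }
    qed
    interpret H: ring_hom_ring R "R Quot ?P (Suc n)" "\<lambda>x. ?P (Suc n) +> x"
      by (rule ideal.rcos_ring_hom_ring[OF id])
    have "(h p \<otimes>\<^bsub>?G\<^esub> h q) n = (\<Oplus>\<^bsub>R Quot ?P (Suc n)\<^esub> i \<in> {..n}.
        rcoset_mult R (?P (Suc n)) (h p i) (h q (n - i)))"
      by (simp only: assoc_graded_def monoid.simps)
    also have "\<dots> = (\<Oplus>\<^bsub>R Quot ?P (Suc n)\<^esub> i \<in> {..n}. ?P (Suc n) +> (p i \<otimes> q (n - i)))"
    proof (rule H.S.finsum_cong')
      show "(\<lambda>i. ?P (Suc n) +> (p i \<otimes> q (n - i))) \<in> {..n} \<rightarrow> carrier (R Quot ?P (Suc n))"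
        using c by (intro Pi_I H.hom_closed m_closed) 
    qed (simp_all only: eq atMost_iff)
    also have "\<dots> = ?P (Suc n) +> (\<Oplus> i \<in> {..n}. p i \<otimes> q (n - i))"
      using H.hom_finsum[of "\<lambda>i. p i \<otimes> q (n - i)" "{..n}"] c by (simp add: o_def)
    also have "\<dots> = h (p \<otimes>\<^bsub>UP R\<^esub> q) n"
      by (simp only: h_def UPmult[OF up])
    finally show "h (p \<otimes>\<^bsub>UP R\<^esub> q) n = (h p \<otimes>\<^bsub>?G\<^esub> h q) n" by (rule sym)
  qed
  have hadd: "h (p \<oplus>\<^bsub>UP R\<^esub> q) = h p \<oplus>\<^bsub>?G\<^esub> h q" if p: "p \<in> S" and q: "q \<in> S" for p q
  proof
    fix n
    have up: "p \<in> up R" "q \<in> up R" using p q by (simp_all only: S_def mem_Collect_eq)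
    have "h (p \<oplus>\<^bsub>UP R\<^esub> q) n = ?P (Suc n) +> (p n \<oplus> q n)"
      by (simp only: h_def UPadd[OF up])
    also have "\<dots> = (?P (Suc n) +> p n) <+> (?P (Suc n) +> q n)"
      using ring_hom_add[OF hom Scarr[OF p] Scarr[OF q], of "Suc n" n n]
      by (simp only: FactRing_def ring.simps)
    also have "\<dots> = (h p \<oplus>\<^bsub>?G\<^esub> h q) n"
      by (simp only: h_def assoc_graded_def ring.simps)
    finally show "h (p \<oplus>\<^bsub>UP R\<^esub> q) n = (h p \<oplus>\<^bsub>?G\<^esub> h q) n" .
  qed
  have hone: "h \<one>\<^bsub>UP R\<^esub> = \<one>\<^bsub>?G\<^esub>" and hzero: "h \<zero>\<^bsub>UP R\<^esub> = \<zero>\<^bsub>?G\<^esub>"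
    using coset_zero[OF additive_subgroup.zero_closed[OF ideal.axioms(1)[OF id]]]
    unfolding h_def UPsel assoc_graded_def by (auto intro!: ext)
  have "h \<in> ring_hom ((UP R)\<lparr>carrier := S\<rparr>) ?G"
    by (rule ring_hom_memI) (use hS hmult hadd hone in auto)
  from S.ring_hom_imp_img_ring[OF this] have "ring (?G\<lparr>carrier := carrier ?G, ring.zero := \<zero>\<^bsub>?G\<^esub>\<rparr>)"
    using hS hzero by simp
  then interpret G: ring ?G by simp
  show ?thesis
  proof unfold_locales
    fix x y assume "x \<in> carrier ?G" "y \<in> carrier ?G"
    then obtain p q where "p \<in> S" "q \<in> S" "x = h p" "y = h q" using hS by blast
    then show "x \<otimes>\<^bsub>?G\<^esub> y = y \<otimes>\<^bsub>?G\<^esub> x"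
      using hmult[of p q] hmult[of q p] S.m_comm[of p q] by simp
  qed
qed

section \<open>Cohen-Macaulay rings\<close>

definition ideal_height :: "('a, 'b) ring_scheme \<Rightarrow> 'a set \<Rightarrow> enat" where
  "ideal_height R P = Sup {enat n | n. \<exists>C. (\<forall>i\<le>n. primeideal (C i) R) \<and>
     (\<forall>i<n. C i \<subset> C (Suc i)) \<and> C n = P}"

text \<open>
  The first condition says that each \<open>xs ! i\<close> is a nonzerodivisor modulo its predecessors.
\<close>

definition regular_sequence :: "('a, 'b) ring_scheme \<Rightarrow> 'a list \<Rightarrow> bool" where
  "regular_sequence R xs \<longleftrightarrow> set xs \<subseteq> carrier R \<and>
     (\<forall>i<length xs. \<forall>y\<in>carrier R.
        xs ! i \<otimes>\<^bsub>R\<^esub> y \<in> Idl\<^bsub>R\<^esub> (set (take i xs)) \<longrightarrow> y \<in> Idl\<^bsub>R\<^esub> (set (take i xs))) \<and>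
     Idl\<^bsub>R\<^esub> (set xs) \<noteq> carrier R"

definition ideal_depth :: "('a, 'b) ring_scheme \<Rightarrow> 'a set \<Rightarrow> enat" where
  "ideal_depth R P = Sup {enat (length xs) | xs. set xs \<subseteq> P \<and> regular_sequence R xs}"

text \<open>
  The definition in Eisenbud, Commutative Algebra, Section 18.2: a Noetherian ring in which the
  depth (grade) of every maximal ideal equals its height.
\<close>

definition cohen_macaulay :: "('a, 'b) ring_scheme \<Rightarrow> bool" where
  "cohen_macaulay R \<longleftrightarrow> cring R \<and> noetherian_ring R \<and>
     (\<forall>P. maximalideal P R \<longrightarrow> ideal_depth R P = ideal_height R P)"


section \<open>Numerical semigroup rings\<close>

text \<open>The ring \<open>k[[H]]\<close> of all power series whose support is contained in \<open>H\<close>.\<close>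

definition semigroup_ring :: "nat set \<Rightarrow> 'k::field fps ring" where
  "semigroup_ring H = ring_of_type_algebra\<lparr>carrier := {f. \<forall>n. fps_nth f n \<noteq> 0 \<longrightarrow> n \<in> H}\<rparr>"

lemma cring_semigroup_ring:
  assumes "0 \<in> H" and add: "\<And>x y. x \<in> H \<Longrightarrow> y \<in> H \<Longrightarrow> x + y \<in> H"
  shows "cring (semigroup_ring H :: 'k::field fps ring)"
proof -
  interpret R: cring "ring_of_type_algebra :: 'k fps ring" by (rule cring_from_type_algebra)
  let ?C = "{f :: 'k fps. \<forall>n. fps_nth f n \<noteq> 0 \<longrightarrow> n \<in> H}"
  have minus: "\<ominus>\<^bsub>ring_of_type_algebra\<^esub> f = - f" for f :: "'k fps"
    by (rule R.minus_equality) (auto simp: ring_of_type_algebra_def)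
  have mult: "f * g \<in> ?C" if fg: "f \<in> ?C" "g \<in> ?C" for f g
  proof (clarsimp)
    fix n assume "fps_nth (f * g) n \<noteq> 0"
    then obtain i where "i \<le> n" "fps_nth f i * fps_nth g (n - i) \<noteq> 0"
      unfolding fps_mult_nth by (meson atLeastAtMost_iff sum.not_neutral_contains_not_neutral)
    then have "i \<in> H" "n - i \<in> H" using fg by auto
    then show "n \<in> H" using add[of i "n - i"] \<open>i \<le> n\<close> by simp
  qed
  have plus: "f + g \<in> ?C" if "f \<in> ?C" "g \<in> ?C" for f g
    using that by (auto) (metis add.right_neutral)
  have sel: "carrier (ring_of_type_algebra :: 'k fps ring) = UNIV"
    "f \<otimes>\<^bsub>ring_of_type_algebra\<^esub> g = f * g" "f \<oplus>\<^bsub>ring_of_type_algebra\<^esub> g = f + g"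
    "\<one>\<^bsub>ring_of_type_algebra\<^esub> = (1 :: 'k fps)" for f g :: "'k fps"
    by (simp_all add: ring_of_type_algebra_def)
  have "subring ?C ring_of_type_algebra"
  proof (rule R.subringI)
    show "\<one>\<^bsub>ring_of_type_algebra\<^esub> \<in> ?C" using assms(1) by (simp add: sel fps_one_nth)
  qed (simp_all only: sel minus mult plus subset_UNIV, simp)
  then have "subcring ?C ring_of_type_algebra" by (rule R.subcringI')
  then show ?thesis
    unfolding semigroup_ring_def using R.subcring_iff[of ?C] by (simp add: sel)
qed

end

theory Submission
  imports Defs "HOL-Library.Set_Algebras"
begin

text \<open>
  All ideals involved are monomial, so a power of \<open>I\<close> is determined by its set of exponents.  The
  ideal \<open>\<mm>\<^sup>q\<close> is the conductor \<open>t\<^sup>a\<^sup>q k[[t]]\<close>, whence \<open>I\<close> has the exponents \<open>E = {n \<in> H. n \<ge> s}\<close>.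
  Put \<open>N = a - l\<close>.  Relative to \<open>s\<close>, the elements of \<open>E\<close> are \<open>0\<close>, \<open>1\<close> and numbers greater than \<open>N\<close>,
  so a sum of \<open>N - 1\<close> elements never equals \<open>h = (N - 1) s + N\<close>.  This is the only number above
  \<open>(N - 1) s\<close> that is missed, and \<open>I\<^sup>n\<close> contains every power series of order at least \<open>n s\<close> once
  \<open>n \<ge> N\<close>.  This gives the reduction number, and since \<open>h \<in> H\<close>, the monomial \<open>t\<^sup>s\<^sup>+\<^sup>h\<close> lies in
  \<open>Q \<inter> I\<^sup>N\<close> but not in \<open>Q I\<^sup>N\<^sup>-\<^sup>1\<close>.  Moreover \<open>t\<^sup>h \<in> I\<^sup>N\<^sup>-\<^sup>2\<close>, and its class in degree \<open>N - 2\<close> of the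
  associated graded ring is nonzero and annihilated by the graded maximal ideal, which therefore has
  depth \<open>0\<close>.  Its height is positive: reading off the coefficients of \<open>t\<^sup>n\<^sup>s\<close> in degree \<open>n\<close> is a
  ring homomorphism into \<open>k[[X]]\<close>, whose kernel is a strictly smaller prime.
\<close>

section \<open>Monomial ideals of semigroup rings\<close>

definition supported :: "nat set \<Rightarrow> 'k::field fps set" where
  "supported E = {f. \<forall>n. fps_nth f n \<noteq> 0 \<longrightarrow> n \<in> E}"

lemma supportedD: "f \<in> supported E \<Longrightarrow> fps_nth f n \<noteq> 0 \<Longrightarrow> n \<in> E"
  by (simp add: supported_def)

lemma supported_nth_eq_0: "f \<in> supported E \<Longrightarrow> n \<notin> E \<Longrightarrow> fps_nth f n = 0"
  by (auto simp: supported_def)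

lemma supported_mono: "E \<subseteq> F \<Longrightarrow> supported E \<subseteq> supported F"
  by (auto simp: supported_def)

lemma X_power_supported_iff [simp]: "fps_X ^ n \<in> (supported E :: 'k::field fps set) \<longleftrightarrow> n \<in> E"
  by (auto simp: supported_def fps_X_power_nth)

lemma const_supported: "0 \<in> E \<Longrightarrow> fps_const c \<in> supported E"
  by (auto simp: supported_def)

lemma zero_supported [simp]: "0 \<in> supported E"
  by (simp add: supported_def)

lemma add_supported: "f \<in> supported E \<Longrightarrow> g \<in> supported E \<Longrightarrow> f + g \<in> supported E"
  by (auto simp: supported_def) (metis add.right_neutral)

lemma mult_supported:
  assumes "f \<in> supported E" "g \<in> supported F"
  shows "f * g \<in> supported (E + F)"
  unfolding supported_def
proof clarify
  fix n assume "fps_nth (f * g) n \<noteq> 0"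
  then obtain i where "i \<le> n" "fps_nth f i * fps_nth g (n - i) \<noteq> 0"
    unfolding fps_mult_nth by (meson atLeastAtMost_iff sum.not_neutral_contains_not_neutral)
  then have "i \<in> E" "n - i \<in> F" using assms by (auto dest: supportedD)
  then show "n \<in> E + F" using \<open>i \<le> n\<close> by (metis le_add_diff_inverse set_plus_intro)
qed

lemma supported_eqD: "(supported E :: 'k::field fps set) = supported F \<Longrightarrow> E = F"
  by (metis X_power_supported_iff subsetI subset_antisym)

text \<open>The zeroth power of an ideal is the whole ring, so the recursion starts at
  \<open>H\<close> and not at \<open>{0}\<close>.\<close>

primrec ideal_exps :: "nat set \<Rightarrow> nat set \<Rightarrow> nat \<Rightarrow> nat set" where
  "ideal_exps H E 0 = H"
| "ideal_exps H E (Suc n) = ideal_exps H E n + E"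

locale semigroup_algebra =
  fixes H :: "nat set" and A :: "'k::field fps ring" (structure)
  assumes zero_mem: "0 \<in> H"
    and add_mem: "\<And>x y. x \<in> H \<Longrightarrow> y \<in> H \<Longrightarrow> x + y \<in> H"
    and A_eq: "A = semigroup_ring H"
begin

sublocale cring A
  unfolding A_eq by (rule cring_semigroup_ring) (fact zero_mem add_mem)+

lemma A_simps [simp]:
  "carrier A = supported H" "f \<otimes> g = f * g" "f \<oplus> g = f + g" "\<one> = 1" "\<zero> = 0"
  by (simp_all add: A_eq semigroup_ring_def ring_of_type_algebra_def supported_def)

lemma a_inv_simp [simp]: "f \<in> supported H \<Longrightarrow> \<ominus> f = - f"
  using l_neg[of f] by (simp add: eq_neg_iff_add_eq_0)

lemma finsum_simp:
  assumes "finite S" "\<And>i. i \<in> S \<Longrightarrow> f i \<in> supported H"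
  shows "finsum A f S = sum f S"
  using assms by (induction S rule: finite_induct) (simp_all add: Pi_def)

lemma ideal_supported:
  assumes "E \<subseteq> H" "E + H \<subseteq> E"
  shows "ideal (supported E) A"
proof (rule idealI)
  show "subgroup (supported E) (add_monoid A)"
  proof (rule subgroup.intro)
    fix f :: "'k fps" assume f: "f \<in> supported E"
    then have "f \<in> carrier A" using supported_mono[OF assms(1)] by auto
    then have "inv\<^bsub>add_monoid A\<^esub> f = - f" unfolding a_inv_def[symmetric] by simp
    then show "inv\<^bsub>add_monoid A\<^esub> f \<in> supported E" using f by (simp add: supported_def)
  qed (use supported_mono[OF assms(1)] in \<open>auto simp: add_supported\<close>)
next
  fix f x :: "'k fps" assume "f \<in> supported E" "x \<in> carrier A"
  then have "f * x \<in> supported E"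
    using mult_supported[of f E x H] supported_mono[OF assms(2)] by auto
  then show "x \<otimes> f \<in> supported E" "f \<otimes> x \<in> supported E" by (simp_all add: mult.commute)
qed (rule ring_axioms)

lemma ideal_prod_supported_subset: "supported E \<cdot> supported F \<subseteq> supported (E + F)"
proof
  fix f :: "'k fps" assume "f \<in> supported E \<cdot> supported F"
  then show "f \<in> supported (E + F)"
    by (induction rule: ideal_prod.induct) (simp_all add: mult_supported add_supported)
qed

text \<open>An element of an ideal product is a finite sum of products, while a power series may
  have infinite support. Finiteness of \<open>G\<close> bridges the two: a series splits into
  finitely many pieces, one for each generator \<open>e\<close>, each being \<open>fps_X ^ e\<close>
  times a series supported in \<open>F\<close>.\<close>

lemma ideal_prod_supported:
  assumes "E = G + H" "finite G" "F + H \<subseteq> F"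
  shows "supported E \<cdot> supported F = supported (E + F)"
proof (rule equalityI[OF ideal_prod_supported_subset])
  have split: "f \<in> supported E \<cdot> supported F" if "finite G'" "G' \<subseteq> G" "f \<in> supported (G' + F)"
    for G' and f :: "'k fps"
    using that
  proof (induction G' arbitrary: f rule: finite_induct)
    case empty
    then have "f = 0 * 0" by (auto simp: supported_def fps_eq_iff set_plus_def)
    then show ?case using ideal_prod.prod[of 0 "supported E" 0 "supported F" A] by simp
  next
    case (insert e G')
    \<comment> \<open>\<open>f1\<close> collects the terms that \<open>fps_X ^ e\<close> divides
      with quotient supported in \<open>F\<close>; the rest \<open>f2\<close> is left to the
      generators in \<open>G'\<close>.\<close>
    define f1 where "f1 = Abs_fps (\<lambda>n. if n \<in> {e} + F then fps_nth f n else 0)"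
    define f2 where "f2 = Abs_fps (\<lambda>n. if n \<in> {e} + F then 0 else fps_nth f n)"
    have "fps_nth f2 n = 0" if "n \<notin> G' + F" for n
      using supportedD[OF insert.prems(2), of n] that 
      by (auto simp: f2_def set_plus_def)
    then have "f2 \<in> supported (G' + F)" by (auto simp: supported_def)
    then have 2: "f2 \<in> supported E \<cdot> supported F" using insert by auto
    have "f1 = fps_X ^ e * fps_shift e f1"
      by (auto simp: fps_eq_iff fps_X_power_mult_nth f1_def set_plus_def)
    moreover have "fps_shift e f1 \<in> supported F"
      by (auto simp: supported_def f1_def set_plus_def)
    moreover have "e \<in> E"
      using insert.prems(1) assms(1) set_plus_intro[OF _ zero_mem, of e G] by auto
    ultimately have 1: "f1 \<in> supported E \<cdot> supported F"
      using ideal_prod.prod[of "fps_X ^ e" "supported E" "fps_shift e f1" "supported F" A] by simp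
    have "f = f1 + f2" by (simp add: fps_eq_iff f1_def f2_def)
    then show ?case using ideal_prod.sum[OF 1 2] by simp
  qed
  have "E + F \<subseteq> G + F"
    unfolding assms(1) using assms(3) by (metis add.assoc add.commute order_refl set_plus_mono2)
  then show "supported (E + F) \<subseteq> supported E \<cdot> supported F"
    using split[OF assms(2)] supported_mono by blast
qed

lemma ideal_exps_closed:
  assumes "E + H \<subseteq> E" shows "ideal_exps H E n + H \<subseteq> ideal_exps H E n"
proof (cases n)
  case 0
  then show ?thesis using add_mem by (auto elim!: set_plus_elim)
next
  case (Suc m)
  then show ?thesis using assms by (simp add: add.assoc set_plus_mono2)
qed

lemma one_ideals_set [simp]: "\<one>\<^bsub>ideals_set A\<^esub> = supported H"
  by (simp add: ideals_set_def)

lemma ideal_pow_Suc: "ideal_pow A J (Suc n) = ideal_pow A J n \<cdot> J"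
  by (simp add: ideals_set_def)

lemma ideal_pow_supported:
  assumes E: "E = G + H" "finite G" "G \<subseteq> H"
  shows "ideal_pow A (supported E) n = supported (ideal_exps H E n)"
proof (induction n)
  case (Suc n)
  have HH: "H + H \<subseteq> H" using add_mem by (auto elim!: set_plus_elim)
  then have "E + H \<subseteq> E" by (simp add: E add.assoc set_plus_mono2)
  moreover have "E \<subseteq> H" using set_plus_mono2[OF E(3) order_refl] HH E(1) by blast
  ultimately have "ideal (supported (ideal_exps H E n)) A" "ideal (supported E) A"
    and cl: "ideal_exps H E n + H \<subseteq> ideal_exps H E n"
    using ideal_exps_closed ideal_supported ideal_pow_is_ideal[of "supported E" n]
    by (simp_all add: Suc.IH)
  \<comment> \<open>The product is commuted so that the finitely generated factor stands on the
    left; of the other factor only closure under adding \<open>H\<close> is asked.\<close>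
  then have "ideal_pow A (supported E) (Suc n) = supported E \<cdot> supported (ideal_exps H E n)"
    unfolding ideal_pow_Suc Suc.IH by (intro ideal_prod_commute)
  also have "\<dots> = supported (ideal_exps H E (Suc n))"
    using ideal_prod_supported[OF E(1,2) cl] by (simp add: add.commute)
  finally show ?case .
qed simp

lemma genideal_X_power:
  assumes "s \<in> H" shows "Idl {fps_X ^ s} = supported ({s} + H)"
proof
  have "{s} + H \<subseteq> H" "{s} + H + H \<subseteq> {s} + H"
    using assms add_mem by (auto elim!: set_plus_elim simp: add.assoc)
  then show "Idl {fps_X ^ s} \<subseteq> supported ({s} + H)"
    using zero_mem by (intro genideal_minimal ideal_supported) (auto simp: set_plus_def)
  show "supported ({s} + H) \<subseteq> Idl {fps_X ^ s}"
  proof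
    fix f :: "'k fps" assume f: "f \<in> supported ({s} + H)"
    have "f = fps_shift s f * fps_X ^ s"
      using f by (auto simp: fps_eq_iff fps_X_power_mult_right_nth supported_def set_plus_def)
    moreover have "fps_shift s f \<in> supported H"
      using f by (fastforce simp: supported_def set_plus_def)
    moreover have "fps_X ^ s \<in> carrier A" using assms by simp
    ultimately show "f \<in> Idl {fps_X ^ s}"
      using cgenideal_eq_genideal[of "fps_X ^ s"] by (auto simp: cgenideal_def)
  qed
qed

end

section \<open>Representatives for the associated graded ring\<close>

text \<open>The powers enter as a parameter \<open>F\<close>, so that an explicit description of
  them can be substituted in an interpretation.\<close>

locale associated_graded = cring R for R (structure) +
  fixes J :: "'a set" and F :: "nat \<Rightarrow> 'a set"
  assumes ideal_J: "ideal J R" and F_eq: "\<And>n. F n = ideal_pow R J n"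
begin

abbreviation G where "G \<equiv> assoc_graded R J"

text \<open>\<open>p\<close> chooses a representative in each degree; computations in
  \<open>G\<close> thereby become convolutions of sequences in \<open>R\<close>.\<close>

definition graded_class :: "(nat \<Rightarrow> 'a) \<Rightarrow> nat \<Rightarrow> 'a set" where
  "graded_class p = (\<lambda>n. F (Suc n) +> p n)"

sublocale G: cring G
  by (rule cring_assoc_graded[OF ideal_J])

lemma ideal_F: "ideal (F n) R"
  unfolding F_eq by (rule ideal_pow_is_ideal[OF ideal_J])

lemma F_carrier: "x \<in> F n \<Longrightarrow> x \<in> carrier R"
  by (rule ideal.Icarr[OF ideal_F])

lemma zero_F: "\<zero> \<in> F n"
  by (rule additive_subgroup.zero_closed[OF ideal.axioms(1)[OF ideal_F]])

lemma add_F: "x \<in> F n \<Longrightarrow> y \<in> F n \<Longrightarrow> x \<oplus> y \<in> F n"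
  by (rule additive_subgroup.a_closed[OF ideal.axioms(1)[OF ideal_F]])

lemma mult_F: "x \<in> F i \<Longrightarrow> y \<in> F j \<Longrightarrow> x \<otimes> y \<in> F (i + j)"
  unfolding F_eq by (rule ideal_pow_mult[OF ideal_J])

lemma F_Suc_subset: "F (Suc n) \<subseteq> F n"
  unfolding F_eq by (rule ideal_pow_Suc_subset[OF ideal_J])

lemma finsum_F: "(\<And>i. i \<le> m \<Longrightarrow> f i \<in> F n) \<Longrightarrow> (\<Oplus>i\<in>{..m::nat}. f i) \<in> F n"
proof (induction m)
  case 0
  then show ?case using F_carrier by simp
next
  case (Suc m)
  then have "f \<in> {..Suc m} \<rightarrow> carrier R" using F_carrier by blast
  then show ?case using Suc by (simp add: add_F)
qed

lemma coset_eq_iff: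
  "x \<in> carrier R \<Longrightarrow> y \<in> carrier R \<Longrightarrow> F n +> x = F n +> y \<longleftrightarrow> x \<ominus> y \<in> F n"
  by (rule quotient_eq_iff_same_a_r_cos[OF ideal_F, symmetric])

lemma coset_zero: "F n +> \<zero> = F n"
proof -
  have "F n \<subseteq> carrier R" using F_carrier by blast
  then show ?thesis by (rule a_coset_add_zero)
qed

lemma coset_mem: "x \<in> F n \<Longrightarrow> F n +> x = F n"
  using coset_eq_iff[of x \<zero> n] F_carrier[of x n] by (simp add: coset_zero minus_eq)

text \<open>Three different powers are involved. Other representatives \<open>u + x\<close> and
  \<open>v + y\<close> change the product by \<open>u (v + y) + x v\<close>, and both summands lie
  in \<open>F (Suc (i + j))\<close>.\<close>

lemma rcoset_mult_F:
  assumes x: "x \<in> F i" and y: "y \<in> F j"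
  shows "rcoset_mult R (F (Suc (i + j))) (F (Suc i) +> x) (F (Suc j) +> y)
    = F (Suc (i + j)) +> (x \<otimes> y)"
proof (rule equalityI)
  have c: "x \<in> carrier R" "y \<in> carrier R" using x y F_carrier by auto
  show "rcoset_mult R (F (Suc (i + j))) (F (Suc i) +> x) (F (Suc j) +> y)
    \<subseteq> F (Suc (i + j)) +> (x \<otimes> y)"
  proof
    fix z assume "z \<in> rcoset_mult R (F (Suc (i + j))) (F (Suc i) +> x) (F (Suc j) +> y)"
    then obtain u v where u: "u \<in> F (Suc i)" and v: "v \<in> F (Suc j)"
      and z: "z \<in> F (Suc (i + j)) +> ((u \<oplus> x) \<otimes> (v \<oplus> y))"
      by (auto simp: rcoset_mult_def a_r_coset_def')
    have uv: "u \<in> carrier R" "v \<in> carrier R" using u v F_carrier by auto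
    have "v \<oplus> y \<in> F j" using v y F_Suc_subset by (blast intro: add_F)
    then have "u \<otimes> (v \<oplus> y) \<oplus> x \<otimes> v \<in> F (Suc (i + j))"
      using mult_F[OF u, of "v \<oplus> y" j] mult_F[OF x v] by (simp add: add_F)
    moreover have "(u \<oplus> x) \<otimes> (v \<oplus> y) \<ominus> x \<otimes> y = u \<otimes> (v \<oplus> y) \<oplus> x \<otimes> v"
      using c uv by algebra
    ultimately have "F (Suc (i + j)) +> ((u \<oplus> x) \<otimes> (v \<oplus> y)) = F (Suc (i + j)) +> (x \<otimes> y)"
      using c uv by (subst coset_eq_iff) auto
    then show "z \<in> F (Suc (i + j)) +> (x \<otimes> y)" using z by simp
  qed
  have "x \<in> F (Suc i) +> x" "y \<in> F (Suc j) +> y"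
    using c zero_F by (force simp: a_r_coset_def')+
  then show "F (Suc (i + j)) +> (x \<otimes> y)
    \<subseteq> rcoset_mult R (F (Suc (i + j))) (F (Suc i) +> x) (F (Suc j) +> y)"
    by (auto simp: rcoset_mult_def)
qed

lemma graded_class_mult:
  assumes p: "\<And>n. p n \<in> F n" and q: "\<And>n. q n \<in> F n"
  shows "graded_class p \<otimes>\<^bsub>G\<^esub> graded_class q = graded_class (\<lambda>n. \<Oplus>i\<in>{..n}. p i \<otimes> q (n - i))"
proof
  fix n
  interpret hom: ring_hom_ring R "R Quot F (Suc n)" "\<lambda>x. F (Suc n) +> x"
    by (rule ideal.rcos_ring_hom_ring[OF ideal_F])
  have c: "p i \<in> carrier R" "q i \<in> carrier R" for i using p q F_carrier by auto
  have eq: "rcoset_mult R (F (Suc n)) (graded_class p i) (graded_class q (n - i))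
    = F (Suc n) +> (p i \<otimes> q (n - i))" if "i \<le> n" for i
    using rcoset_mult_F[OF p[of i] q[of "n - i"]] that by (simp add: graded_class_def)
  have "(graded_class p \<otimes>\<^bsub>G\<^esub> graded_class q) n = (\<Oplus>\<^bsub>R Quot F (Suc n)\<^esub> i \<in> {..n}.
      rcoset_mult R (F (Suc n)) (graded_class p i) (graded_class q (n - i)))"
    by (simp only: assoc_graded_def monoid.simps F_eq)
  also have "\<dots> = (\<Oplus>\<^bsub>R Quot F (Suc n)\<^esub> i \<in> {..n}. F (Suc n) +> (p i \<otimes> q (n - i)))"
    using c by (intro hom.S.finsum_cong') (simp_all add: eq)
  also have "\<dots> = graded_class (\<lambda>n. \<Oplus>i\<in>{..n}. p i \<otimes> q (n - i)) n"
    using hom.hom_finsum[of "\<lambda>i. p i \<otimes> q (n - i)" "{..n}"] c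
    by (simp add: graded_class_def o_def)
  finally show "(graded_class p \<otimes>\<^bsub>G\<^esub> graded_class q) n
    = graded_class (\<lambda>n. \<Oplus>i\<in>{..n}. p i \<otimes> q (n - i)) n" .
qed

lemma graded_class_add:
  assumes "\<And>n. p n \<in> F n" "\<And>n. q n \<in> F n"
  shows "graded_class p \<oplus>\<^bsub>G\<^esub> graded_class q = graded_class (\<lambda>n. p n \<oplus> q n)"
proof
  fix n
  have "p n \<in> carrier R" "q n \<in> carrier R" using assms F_carrier by auto
  from ring_hom_add[OF ideal.rcos_ring_hom[OF ideal_F] this]
  show "(graded_class p \<oplus>\<^bsub>G\<^esub> graded_class q) n = graded_class (\<lambda>n. p n \<oplus> q n) n"
    by (simp add: graded_class_def assoc_graded_def FactRing_def)
qed

lemma graded_class_one: "\<one>\<^bsub>G\<^esub> = graded_class (\<lambda>n. if n = 0 then \<one> else \<zero>)"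
  unfolding assoc_graded_def monoid.simps F_eq[symmetric] graded_class_def
  by (rule ext) (simp add: coset_zero)

lemma graded_class_zero: "\<zero>\<^bsub>G\<^esub> = graded_class (\<lambda>n. \<zero>)"
  unfolding assoc_graded_def ring.simps F_eq[symmetric] graded_class_def
  by (rule ext) (simp add: coset_zero)

lemma graded_class_eq_iff:
  assumes "\<And>n. p n \<in> F n" "\<And>n. q n \<in> F n"
  shows "graded_class p = graded_class q \<longleftrightarrow> (\<forall>n. p n \<ominus> q n \<in> F (Suc n))"
  unfolding fun_eq_iff graded_class_def
  using coset_eq_iff[OF F_carrier[OF assms(1)] F_carrier[OF assms(2)]] by simp

lemma graded_class_closed:
  assumes "\<And>n. p n \<in> F n" "finite {n. p n \<noteq> \<zero>}"
  shows "graded_class p \<in> carrier G"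
proof -
  have "{n. graded_class p n \<noteq> F (Suc n)} \<subseteq> {n. p n \<noteq> \<zero>}"
    using coset_zero by (auto simp: graded_class_def)
  then have "finite {n. graded_class p n \<noteq> F (Suc n)}" using assms(2) by (rule finite_subset)
  moreover have "graded_class p n \<in> (\<lambda>x. F (Suc n) +> x) ` F n" for n
    using assms(1) by (auto simp: graded_class_def)
  ultimately show ?thesis
    unfolding assoc_graded_def partial_object.simps F_eq[symmetric] by blast
qed

lemma graded_class_exhaust:
  assumes "g \<in> carrier G" obtains p where "\<And>n. p n \<in> F n" "g = graded_class p"
proof -
  have "\<forall>n. \<exists>x. x \<in> F n \<and> g n = F (Suc n) +> x"
    using assms unfolding assoc_graded_def partial_object.simps F_eq[symmetric] by blast
  then show ?thesis using that unfolding graded_class_def by metis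
qed

definition homogeneous :: "nat \<Rightarrow> 'a \<Rightarrow> nat \<Rightarrow> 'a set" where
  "homogeneous m x = graded_class (\<lambda>n. if n = m then x else \<zero>)"

lemma homogeneous_closed: "x \<in> F m \<Longrightarrow> homogeneous m x \<in> carrier G"
  unfolding homogeneous_def by (rule graded_class_closed) (auto simp: zero_F)

lemma homogeneous_eq_zero_iff: "x \<in> F m \<Longrightarrow> homogeneous m x = \<zero>\<^bsub>G\<^esub> \<longleftrightarrow> x \<in> F (Suc m)"
  unfolding homogeneous_def graded_class_zero
  by (subst graded_class_eq_iff) (auto simp: zero_F minus_eq F_carrier)

lemma mult_homogeneous_eq_zero:
  assumes p: "\<And>n. p n \<in> F n" and x: "x \<in> F m"
    and ann: "\<And>n. p n \<otimes> x \<in> F (Suc (n + m))"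
  shows "graded_class p \<otimes>\<^bsub>G\<^esub> homogeneous m x = \<zero>\<^bsub>G\<^esub>"
proof -
  define q where "q = (\<lambda>n. if n = m then x else \<zero>)"
  have q: "q n \<in> F n" for n using x zero_F by (simp add: q_def)
  \<comment> \<open>Only the term with \<open>n - i = m\<close> can be nonzero, and for it
    \<open>ann\<close> gives the claim.\<close>
  have "p i \<otimes> q (n - i) \<in> F (Suc n)" if "i \<le> n" for i n
    using ann[of i] that zero_F F_carrier[OF p] by (auto simp: q_def)
  then have "(\<Oplus>i\<in>{..n}. p i \<otimes> q (n - i)) \<in> F (Suc n)" for n by (rule finsum_F)
  then have "F (Suc n) +> (\<Oplus>i\<in>{..n}. p i \<otimes> q (n - i)) = F (Suc n) +> \<zero>" for n
    unfolding coset_zero by (rule coset_mem)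
  then show ?thesis
    unfolding homogeneous_def q_def[symmetric] graded_class_mult[OF p q] graded_class_zero
    by (simp add: graded_class_def)
qed

end

section \<open>Depth and height\<close>

text \<open>Since \<open>Idl {}\<close> is zero, the first member of a regular sequence is a
  nonzerodivisor; no element of \<open>P\<close> is one, because \<open>y\<close> is killed by all
  of them. Only the empty sequence remains.\<close>

lemma (in cring) ideal_depth_eq_0:
  assumes "y \<in> carrier R" "y \<noteq> \<zero>" "\<And>x. x \<in> P \<Longrightarrow> x \<otimes> y = \<zero>"
  shows "ideal_depth R P = 0"
proof -
  have Idl: "Idl {} = {\<zero>}"
    using genideal_minimal[OF zeroideal, of "{}"] genideal_ideal[of "{}"]
    by (auto dest: additive_subgroup.zero_closed[OF ideal.axioms(1)])
  have "xs = []" if xs: "set xs \<subseteq> P" "regular_sequence R xs" for xs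
  proof (rule ccontr)
    assume "xs \<noteq> []"
    then have "xs ! 0 \<in> P" "0 < length xs" using xs(1) by auto
    then have "xs ! 0 \<otimes> y \<in> Idl (set (take 0 xs))" using assms(3) by (simp add: Idl)
    then have "y \<in> Idl (set (take 0 xs))"
      using xs(2) \<open>0 < length xs\<close> assms(1) unfolding regular_sequence_def by blast
    then show False using assms(2) by (simp add: Idl)
  qed
  then have "{enat (length xs) | xs. set xs \<subseteq> P \<and> regular_sequence R xs} \<subseteq> {0}"
    by (auto simp: zero_enat_def)
  then have "ideal_depth R P \<le> 0"
    unfolding ideal_depth_def by (intro Sup_least) auto
  then show ?thesis by simp
qed

lemma ideal_height_pos:
  assumes "primeideal P R" "primeideal M R" "P \<subset> M"
  shows "1 \<le> ideal_height R M"
  unfolding ideal_height_def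
proof (rule Sup_upper, clarify, intro exI conjI)
  show "1 = enat 1" by (simp add: one_enat_def)
  show "\<forall>i\<le>1. primeideal ((\<lambda>i. if i = 0 then P else M) i) R" using assms by simp
qed (use assms(3) in auto)

section \<open>The semigroup generated by two consecutive integers\<close>

locale consecutive_semigroup_algebra =
  fixes a :: nat and H :: "nat set" and A :: "'k::field fps ring" (structure)
  assumes a_ge_2: "a \<ge> 2"
    and H_eq: "H = {\<alpha> * a + \<beta> * (a + 1) | \<alpha> \<beta>. True}"
    and A_semigroup_ring: "A = semigroup_ring H"
begin

text \<open>Take \<open>j = \<alpha> + \<beta>\<close> and \<open>i = \<beta>\<close>:
  \<open>H\<close> is the union of the intervals from \<open>a * j\<close> to
  \<open>a * j + j\<close>. Below, \<open>j\<close> is called the index and \<open>i\<close> the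
  offset.\<close>

lemma mem_H_iff: "n \<in> H \<longleftrightarrow> (\<exists>j i. i \<le> j \<and> n = a * j + i)"
proof
  assume "n \<in> H"
  then obtain \<alpha> \<beta> where "n = \<alpha> * a + \<beta> * (a + 1)" by (auto simp: H_eq)
  then have "\<beta> \<le> \<alpha> + \<beta> \<and> n = a * (\<alpha> + \<beta>) + \<beta>" by (simp add: algebra_simps)
  then show "\<exists>j i. i \<le> j \<and> n = a * j + i" by blast
next
  assume "\<exists>j i. i \<le> j \<and> n = a * j + i"
  then obtain j i where "i \<le> j" "n = a * j + i" by blast
  then have "n = (j - i) * a + i * (a + 1)"
    by (metis add.assoc add.commute add_mult_distrib add_mult_distrib2 le_add_diff_inverse2 mult.commute mult.right_neutral)
  then show "n \<in> H" by (auto simp: H_eq)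
qed

lemma mem_H: "i \<le> j \<Longrightarrow> a * j + i \<in> H"
  by (auto simp: mem_H_iff)

sublocale semigroup_algebra H A
proof
  show "0 \<in> H" using mem_H[of 0 0] by simp
  fix x y assume "x \<in> H" "y \<in> H"
  then obtain j i j' i' where "i \<le> j" "x = a * j + i" "i' \<le> j'" "y = a * j' + i'"
    by (auto simp: mem_H_iff)
  then have "i + i' \<le> j + j' \<and> x + y = a * (j + j') + (i + i')" by (simp add: algebra_simps)
  then show "x + y \<in> H" unfolding mem_H_iff by blast
qed (rule A_semigroup_ring)

text \<open>One generator is split off: \<open>a\<close> if the offset is smaller than the index,
  \<open>a + 1\<close> if they are equal.\<close>

lemma H_cases:
  assumes "n \<in> H" obtains "n = 0" | m where "m \<in> H" "n = m + a \<or> n = m + (a + 1)"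
proof -
  obtain j i where ji: "i \<le> j" "n = a * j + i" using assms by (auto simp: mem_H_iff)
  consider "j = 0" | j' where "j = Suc j'" "i \<le> j'" | j' where "j = Suc j'" "i = Suc j'"
    using ji(1) by (cases j) (auto simp: le_Suc_eq)
  then show ?thesis
  proof cases
    case 2
    then show ?thesis using that(2)[OF mem_H[of i j']] ji by simp
  next
    case 3
    then show ?thesis using that(2)[OF mem_H[of j' j']] ji by simp
  qed (use that ji in auto)
qed

lemma conductor_mem_H:
  assumes "n \<ge> a * (a - 1)" shows "n \<in> H"
proof -
  have "n div a \<ge> a - 1" using div_le_mono[OF assms, of a] a_ge_2 by simp
  moreover have "n mod a \<le> a - 1"
    using mod_less_divisor[of a n] a_ge_2 by linarith
  ultimately have "a * (n div a) + n mod a \<in> H" by (intro mem_H) linarith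
  then show ?thesis by simp
qed

text \<open>The interval of index \<open>a - 2\<close> ends at \<open>a * (a - 1) - 2\<close>, and
  the next one starts at \<open>a * (a - 1)\<close>.\<close>

lemma Frobenius_number: "a * (a - 1) - 1 \<notin> H"
proof
  assume "a * (a - 1) - 1 \<in> H"
  then obtain j i where ji: "i \<le> j" "a * (a - 1) - 1 = a * j + i" by (auto simp: mem_H_iff)
  have pos: "a * (a - 1) > 0" using a_ge_2 by simp
  show False
  proof (cases "j \<ge> a - 1")
    case True
    then have "a * j \<ge> a * (a - 1)" by simp
    then show False using ji(2) pos by linarith
  next
    case False
    then have "a * (j + 1) \<le> a * (a - 1)" by (intro mult_le_mono2) simp
    moreover have "i + 1 < a" using ji False by linarith
    ultimately show False using ji(2) by simp
  qed
qed

section \<open>Powers of the maximal ideal and the colon ideal\<close>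

abbreviation max_ideal where "max_ideal \<equiv> Idl {fps_X ^ a, fps_X ^ (a + 1)}"

lemma generators_subset: "{fps_X ^ a, fps_X ^ (a + 1)} \<subseteq> carrier A"
  using mem_H[of 0 1] mem_H[of 1 1] by (simp del: power_Suc)

lemma X_power_mem_max_ideal_pow:
  "k \<le> j \<Longrightarrow> i \<le> j \<Longrightarrow> fps_X ^ (a * j + i) \<in> ideal_pow A max_ideal k"
proof (induction k arbitrary: j i)
  case 0
  then show ?case using mem_H by simp
next
  case (Suc k)
  then obtain j' where j: "j = Suc j'" "k \<le> j'" by (metis Suc_le_D Suc_le_mono)
  have gen: "fps_X ^ a \<in> max_ideal" "fps_X ^ (a + 1) \<in> max_ideal"
    using genideal_self[OF generators_subset] by auto
  have eq: "(fps_X ^ (a * j + i) :: 'k fps) =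
    (if i \<le> j' then fps_X ^ (a * j' + i) * fps_X ^ a else fps_X ^ (a * j' + j') * fps_X ^ (a + 1))"
    using Suc.prems(2) j(1) by (auto simp: power_add[symmetric] le_Suc_eq algebra_simps simp del: power_Suc)
  show ?case
    unfolding ideal_pow_Suc eq
    using Suc.IH[OF j(2)] ideal_prod.prod[OF _ gen(1), of _ "ideal_pow A max_ideal k" A, unfolded A_simps]
      ideal_prod.prod[OF _ gen(2), of _ "ideal_pow A max_ideal k" A, unfolded A_simps]
    by (simp del: power_Suc)
qed

text \<open>With \<open>X_power_mem_max_ideal_pow\<close>, this is what is used of the power
  \<open>a - 1\<close> being the conductor: its elements have order at least
  \<open>a * (a - 1)\<close>, and it contains all monomials from there on.\<close>

lemma max_ideal_pow_subset: "ideal_pow A max_ideal k \<subseteq> supported {a * k..}"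
proof (induction k)
  case 0
  have "supported H \<subseteq> supported {0..}" by (intro supported_mono) auto
  then show ?case by simp
next
  case (Suc k)
  let ?E = "H \<inter> {a..}"
  have "ideal (supported ?E) A"
    using add_mem by (intro ideal_supported) (auto elim!: set_plus_elim)
  then have "max_ideal \<subseteq> supported ?E"
    using mem_H[of 0 1] mem_H[of 1 1] by (intro genideal_minimal) (auto simp del: power_Suc)
  then have max: "max_ideal \<subseteq> supported {a..}" using supported_mono[of ?E "{a..}"] by blast
  have "ideal_pow A max_ideal k \<cdot> max_ideal \<subseteq> supported {a * k..} \<cdot> supported {a..}"
  proof
    fix f :: "'k fps" assume "f \<in> ideal_pow A max_ideal k \<cdot> max_ideal"
    then show "f \<in> supported {a * k..} \<cdot> supported {a..}"
      by (induction rule: ideal_prod.induct) (use Suc max in \<open>blast intro: ideal_prod.intros\<close>)+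
  qed
  also have "\<dots> \<subseteq> supported ({a * k..} + {a..})" by (rule ideal_prod_supported_subset)
  also have "\<dots> \<subseteq> supported {a * Suc k..}"
    by (intro supported_mono) (auto elim!: set_plus_elim)
  finally show ?case unfolding ideal_pow_Suc .
qed

text \<open>A series of order at least \<open>s\<close> is moved by the conductor to exponents in
  \<open>s + H\<close>. Conversely, a term of order below \<open>s\<close> can be moved exactly to
  \<open>s\<close> plus the Frobenius number, which is outside \<open>s + H\<close>.\<close>

lemma colon_conductor:
  assumes s: "s \<in> H" "s < a * (a - 1)"
  shows "colon_ideal A (Idl {fps_X ^ s}) (ideal_pow A max_ideal (a - 1)) = supported (H \<inter> {s..})"
    (is "colon_ideal A ?Q ?M = _")
proof
  have Q: "?Q = supported ({s} + H)" by (rule genideal_X_power[OF s(1)])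
  show "supported (H \<inter> {s..}) \<subseteq> colon_ideal A ?Q ?M"
  proof
    fix f :: "'k fps" assume f: "f \<in> supported (H \<inter> {s..})"
    have "f * g \<in> ?Q" if "g \<in> ?M" for g
    proof -
      have "f * g \<in> supported (H \<inter> {s..} + {a * (a - 1)..})"
        using f that max_ideal_pow_subset by (blast intro: mult_supported)
      also have "\<dots> \<subseteq> ?Q"
        unfolding Q
      proof (intro supported_mono subsetI)
        fix n assume "n \<in> H \<inter> {s..} + {a * (a - 1)..}"
        then have "n \<ge> s + a * (a - 1)" by (auto elim!: set_plus_elim)
        then have "n = s + (n - s)" "n - s \<in> H" by (auto intro: conductor_mem_H)
        then show "n \<in> {s} + H" by (metis set_plus_intro singletonI)
      qed
      finally show ?thesis .
    qed
    moreover have "f \<in> supported H" using f supported_mono[of "H \<inter> {s..}" H] by auto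
    ultimately show "f \<in> colon_ideal A ?Q ?M" by (simp add: colon_ideal_def)
  qed
  show "colon_ideal A ?Q ?M \<subseteq> supported (H \<inter> {s..})"
  proof
    fix f :: "'k fps" assume "f \<in> colon_ideal A ?Q ?M"
    then have f: "f \<in> supported H" "\<forall>g\<in>?M. f * g \<in> ?Q" by (simp_all add: colon_ideal_def)
    have "s \<le> n" if n: "fps_nth f n \<noteq> 0" for n
    proof (rule ccontr)
      assume "\<not> s \<le> n"
      \<comment> \<open>The shift is chosen so that \<open>n + d\<close> is \<open>s\<close> plus
        the Frobenius number; \<open>n < s\<close> makes \<open>d\<close> at least the
        conductor.\<close>
      define d where "d = a * (a - 1) + (s - 1 - n)"
      have "d div a \<ge> a - 1"
        using div_le_mono[of "a * (a - 1)" d a] a_ge_2 by (simp add: d_def)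
      moreover have "d mod a \<le> a - 1" using mod_less_divisor[of a d] a_ge_2 by linarith
      ultimately have "fps_X ^ (a * (d div a) + d mod a) \<in> ?M"
        by (intro X_power_mem_max_ideal_pow) linarith+
      then have "f * fps_X ^ d \<in> ?Q" using f(2) by simp
      moreover have "fps_nth (f * fps_X ^ d) (n + d) \<noteq> 0"
        using n by (simp add: fps_X_power_mult_right_nth)
      ultimately have "n + d \<in> {s} + H" unfolding Q by (rule supportedD)
      moreover have "n + d = s + (a * (a - 1) - 1)"
        using \<open>\<not> s \<le> n\<close> a_ge_2 by (simp add: d_def)
      ultimately show False using Frobenius_number by (auto simp: set_plus_def)
    qed
    then show "f \<in> supported (H \<inter> {s..})" using f(1) by (simp add: supported_def)
  qed
qed

text \<open>Provides the finite set of generators for \<open>ideal_pow_supported\<close>: above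
  \<open>s + a\<close>, one of \<open>a\<close> and \<open>a + 1\<close> can be removed without
  falling below \<open>s\<close>.\<close>

lemma H_above_generated: "H \<inter> {s..} = H \<inter> {s..s + a} + H"
proof
  show "H \<inter> {s..s + a} + H \<subseteq> H \<inter> {s..}" using add_mem by (auto elim!: set_plus_elim)
  have "n \<in> H \<Longrightarrow> s \<le> n \<Longrightarrow> n \<in> H \<inter> {s..s + a} + H" for n
  proof (induction n rule: less_induct)
    case (less n)
    show ?case
    proof (cases "n \<le> s + a")
      case True
      then show ?thesis using less.prems set_plus_intro[of n "H \<inter> {s..s + a}" 0 H] zero_mem by simp
    next
      case False
      with less.prems obtain m where m: "m \<in> H" "n = m + a \<or> n = m + (a + 1)"
        by (auto elim: H_cases)
      then have "m \<in> H \<inter> {s..s + a} + H" using less.IH[of m] False a_ge_2 by auto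
      moreover have "a \<in> H" "a + 1 \<in> H" using mem_H[of 0 1] mem_H[of 1 1] by simp_all
      ultimately show ?thesis using m(2) add_mem
        by (auto elim!: set_plus_elim simp: add.assoc) (metis (no_types) IntI add.assoc add_Suc_right atLeastAtMost_iff set_plus_intro)+
    qed
  qed
  then show "H \<inter> {s..} \<subseteq> H \<inter> {s..s + a} + H" by auto
qed

end

section \<open>Exponents of the powers of the colon ideal\<close>

locale boundary_colon = consecutive_semigroup_algebra a H A
  for a :: nat and H :: "nat set" and A :: "'k::field fps ring" (structure) +
  fixes l N s h :: nat and E :: "nat set"
  assumes l_ge_2: "l \<ge> 2" and N_ge_3: "N \<ge> 3" and a_eq: "a = N + l"
    and s_def: "s = a * l + (l - 1)"
    and E_def: "E = H \<inter> {s..}"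
    and h_def: "h = (N - 1) * s + N"
begin

abbreviation E_pow where "E_pow \<equiv> ideal_exps H E"

lemma mult_pred_l: "k * (l - 1) + k = k * l"
proof -
  have "k * (l - 1) + k = k * Suc (l - 1)" by simp
  then show ?thesis using l_ge_2 by simp
qed

lemma s_mem_H: "s \<in> H"
  unfolding s_def by (rule mem_H) simp

lemma s_less_conductor: "s < a * (a - 1)"
proof -
  have "s < a * (l + 1)" using l_ge_2 by (simp add: s_def a_eq)
  also have "\<dots> \<le> a * (a - 1)" using N_ge_3 a_eq by (intro mult_le_mono2) simp
  finally show ?thesis .
qed

lemma mem_E: "s \<in> E" "Suc s \<in> E"
  using s_mem_H mem_H[of l l] l_ge_2 by (auto simp: E_def s_def)

text \<open>\<open>s\<close> and \<open>s + 1\<close> are the last two elements of the interval of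
  index \<open>l\<close>; the next interval starts at
  \<open>a * (l + 1) = s + N + 1\<close>.\<close>

lemma E_cases:
  assumes "n \<in> E" obtains "n = s" | "n = s + 1" | "n \<ge> s + N + 1"
proof -
  obtain j i where ji: "i \<le> j" "n = a * j + i" using assms by (auto simp: E_def mem_H_iff)
  have ns: "s \<le> n" using assms by (simp add: E_def)
  consider "j + 1 \<le> l" | "j = l" | "l + 1 \<le> j" by linarith
  then show ?thesis
  proof cases
    case 1
    then have "a * (j + 1) \<le> a * l" by (intro mult_le_mono2)
    then have "n < s" using ji 1 a_ge_2 by (simp add: s_def)
    then show ?thesis using ns by simp
  next
    case 2
    then have "i = l - 1 \<or> i = l" using ji ns s_def by auto
    then show ?thesis using that(1,2) ji 2 l_ge_2 by (auto simp: s_def)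
  next
    case 3
    then have "a * (l + 1) \<le> a * j" by (intro mult_le_mono2)
    then show ?thesis using that(3) ji(2) a_eq l_ge_2 by (simp add: s_def)
  qed
qed

text \<open>The excess over \<open>k * s\<close> is a sum of \<open>k\<close> excesses, each at most
  1 or at least \<open>N + 1\<close>, and of an element of \<open>H\<close>, which is 0 or at least
  \<open>a\<close>. For \<open>k = N - 1\<close> the only excluded excess is \<open>N\<close>, that
  of \<open>h\<close>.\<close>

lemma E_pow_gap: "n \<in> E_pow k \<Longrightarrow> \<exists>x. n = k * s + x \<and> (x \<le> k \<or> N + 1 \<le> x)"
proof (induction k arbitrary: n)
  case 0
  then obtain j i where "i \<le> j" "n = a * j + i" by (auto simp: mem_H_iff)
  then have "n = 0 \<or> a \<le> n" by (cases j) auto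
  then show ?case using a_eq l_ge_2 by auto
next
  case (Suc k)
  then obtain m e where me: "m \<in> E_pow k" "e \<in> E" "n = m + e" by (auto elim: set_plus_elim)
  with Suc.IH obtain x where x: "m = k * s + x" "x \<le> k \<or> N + 1 \<le> x" by blast
  obtain y where y: "e = s + y" "y \<le> 1 \<or> N + 1 \<le> y"
    using me(2) by (cases rule: E_cases) (use le_Suc_ex in \<open>fastforce+\<close>)
  have "n = Suc k * s + (x + y)" using me(3) x(1) y(1) by simp
  moreover have "x + y \<le> Suc k \<or> N + 1 \<le> x + y" using x(2) y(2) by auto
  ultimately show ?case by blast
qed

text \<open>For \<open>j\<close> at most \<open>k\<close>, add \<open>k - j\<close> elements of
  index \<open>l\<close>, with offsets \<open>l - 1\<close> or \<open>l\<close>, and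
  \<open>j\<close> elements of index \<open>l + 1\<close>, with offsets up to \<open>l + 1\<close>.
  For larger \<open>j\<close> the subtraction truncates to 0, and the surplus index is taken up by
  \<open>E_pow 0 = H\<close>.\<close>

lemma E_pow_interval:
  "(k - j) * (l - 1) \<le> i \<Longrightarrow> i \<le> k * l + j \<Longrightarrow> a * (k * l + j) + i \<in> E_pow k"
proof (induction k arbitrary: j i)
  case 0
  then show ?case using mem_H by simp
next
  case (Suc k)
  show ?case
  proof (cases j)
    case 0
    define c where "c = k * (l - 1)"
    \<comment> \<open>The new summand is \<open>s + 1\<close> if this leaves an offset of at least
      \<open>c\<close> for the others, and \<open>s\<close> otherwise.\<close>
    define e where "e = (if c + l \<le> i then l else l - 1)"
    have "c + (l - 1) \<le> i" "i \<le> k * l + l" using Suc.prems 0 by (simp_all add: c_def)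
    moreover have "c \<le> k * l" by (simp add: c_def)
    ultimately have "e \<le> i \<and> c \<le> i - e \<and> i - e \<le> k * l"
      using l_ge_2 by (cases "c + l \<le> i") (simp_all only: e_def if_True if_False, linarith+)
    then have "e \<le> i" "c \<le> i - e" "i - e \<le> k * l" by simp_all
    then have "a * (k * l) + (i - e) \<in> E_pow k" using Suc.IH[of 0 "i - e"] by (simp add: c_def)
    moreover have "a * l + e \<in> E" using mem_E l_ge_2 by (auto simp: e_def s_def)
    ultimately have "a * (k * l) + (i - e) + (a * l + e) \<in> E_pow (Suc k)" by auto
    moreover have "a * (k * l) + (i - e) + (a * l + e) = a * (Suc k * l + j) + i"
      using 0 \<open>e \<le> i\<close> by (simp add: algebra_simps)
    ultimately show ?thesis by simp
  next
    case (Suc j')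
    \<comment> \<open>The first \<open>k\<close> summands take as much of the offset as they can; at
      most \<open>l + 1\<close> is left for the new one, of index \<open>l + 1\<close>.\<close>
    define i' where "i' = min i (k * l + j')"
    have "(k - j') * (l - 1) \<le> k * l" by (intro mult_le_mono) auto
    then have "(k - j') * (l - 1) \<le> i'" using Suc.prems(1) Suc by (simp add: i'_def)
    then have "a * (k * l + j') + i' \<in> E_pow k" by (intro Suc.IH) (auto simp: i'_def)
    moreover have "a * (l + 1) + (i - i') \<in> E"
    proof -
      have "i - i' \<le> l + 1" using Suc.prems(2) Suc by (auto simp: i'_def)
      then show ?thesis using mem_H[of "i - i'" "l + 1"] by (simp add: E_def s_def a_eq)
    qed
    ultimately have "a * (k * l + j') + i' + (a * (l + 1) + (i - i')) \<in> E_pow (Suc k)" by auto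
    moreover have "a * (k * l + j') + i' + (a * (l + 1) + (i - i')) = a * (Suc k * l + j) + i"
      using Suc by (simp add: i'_def algebra_simps)
    ultimately show ?thesis by simp
  qed
qed

text \<open>
  The intervals of \<open>E_pow_interval\<close> for consecutive values of \<open>j\<close> leave no gap, except for \<open>h\<close> between
  \<open>j = 0\<close> and \<open>j = 1\<close>.
\<close>

lemma E_pow_pred: "E_pow (N - 1) = {(N - 1) * s..} - {h}"
proof
  show "E_pow (N - 1) \<subseteq> {(N - 1) * s..} - {h}"
    using E_pow_gap[of _ "N - 1"] N_ge_3 by (fastforce simp: h_def)
  show "{(N - 1) * s..} - {h} \<subseteq> E_pow (N - 1)"
  proof
    fix m assume m: "m \<in> {(N - 1) * s..} - {h}"
    define k where "k = N - 1"
    have k: "N = k + 1" "k \<ge> 2" using N_ge_3 by (simp_all add: k_def)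
    obtain x where x: "m = k * s + x" "x \<noteq> k + 1"
      using m le_Suc_ex[of "k * s" m] k(1) by (auto simp: h_def)
    then have m_eq: "m = a * (k * l) + (k * (l - 1) + x)" by (simp add: s_def algebra_simps)
    show "m \<in> E_pow (N - 1)"
    proof (cases "x \<le> k")
      case True
      then show ?thesis
        using mult_pred_l[of k] E_pow_interval[of k 0 "k * (l - 1) + x"] True m_eq by (simp add: k_def)
    next
      case False
      \<comment> \<open>Relative to \<open>k * s\<close>, the interval for \<open>j\<close> in
        \<open>E_pow_interval\<close> ends at \<open>a * j + k + j\<close>, so this is the first
        interval that reaches \<open>x\<close>.\<close>
      define j where "j = (LEAST j. x \<le> a * j + k + j)"
      have "x \<le> a * x + k + x" by simp
      then have j_upper: "x \<le> a * j + k + j" unfolding j_def by (rule LeastI)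
      have "j \<noteq> 0" using j_upper False by (cases j) auto
      then obtain j' where j': "j = Suc j'" by (cases j) auto
      have "\<not> x \<le> a * j' + k + j'" 
        using not_less_Least[of j' "\<lambda>j. x \<le> a * j + k + j"] j' unfolding j_def by simp
      then have low: "a * j' + k + j' + 1 \<le> x" by simp
      \<comment> \<open>For \<open>j = 1\<close> this amounts to \<open>x\<close> being at least
        \<open>k + 2\<close>, which is where the exclusion of \<open>h\<close> enters; for larger
        \<open>j\<close> the bound \<open>low\<close> suffices.\<close>
      have "a * j \<le> x + (l - 1)"
        using low x(2) False j' k a_eq l_ge_2 by (cases j') auto
      moreover have "(k - j) * (l - 1) + (l - 1) \<le> k * (l - 1)"
      proof -
        have "(k - j) + 1 \<le> k" using k(2) j' by simp
        then have "((k - j) + 1) * (l - 1) \<le> k * (l - 1)" by (intro mult_le_mono1)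
        then show ?thesis by simp
      qed
      ultimately have i: "(k - j) * (l - 1) + a * j \<le> k * (l - 1) + x" by linarith
      have "a * (k * l + j) + (k * (l - 1) + x - a * j) \<in> E_pow k"
        using i j_upper mult_pred_l[of k] by (intro E_pow_interval) linarith+
      moreover have "a * (k * l + j) + (k * (l - 1) + x - a * j) = m"
        using i m_eq by (simp add: algebra_simps)
      ultimately show ?thesis by (simp add: k_def)
    qed
  qed
qed

text \<open>Since \<open>E\<close> contains both \<open>s\<close> and \<open>s + 1\<close>, the
  single gap of \<open>E_pow (N - 1)\<close> is filled: if \<open>m - s\<close> is \<open>h\<close>,
  then \<open>m - Suc s\<close> is \<open>h - 1\<close>, which is not missing. From then on adding
  \<open>s\<close> is enough.\<close>

lemma E_pow_stable: "N \<le> k \<Longrightarrow> E_pow k = {k * s..}"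
proof (induction k rule: dec_induct)
  case base
  have N: "N = Suc (N - 1)" using N_ge_3 by simp
  show ?case
  proof
    show "E_pow N \<subseteq> {N * s..}" using E_pow_gap[of _ N] by fastforce
    show "{N * s..} \<subseteq> E_pow N"
    proof
      fix m assume "m \<in> {N * s..}"
      then have m: "(N - 1) * s + s \<le> m" using N by (metis add.commute atLeast_iff mult_Suc)
      have "m - s \<in> E_pow (N - 1) \<or> (m - Suc s \<in> E_pow (N - 1) \<and> Suc s \<le> m)"
        using m N_ge_3 unfolding E_pow_pred by (auto simp: h_def)
      then have "m - s + s \<in> E_pow (N - 1) + E \<or> (m - Suc s + Suc s \<in> E_pow (N - 1) + E \<and> Suc s \<le> m)"
        using mem_E by blast
      then have "m \<in> E_pow (N - 1) + E" using m by auto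
      then show "m \<in> E_pow N" using N by (metis ideal_exps.simps(2))
    qed
  qed
next
  case (step k)
  have "{k * s..} + E \<subseteq> {Suc k * s..}" by (auto elim!: set_plus_elim simp: E_def)
  moreover have "m \<in> {k * s..} + E" if "m \<ge> Suc k * s" for m
    using that set_plus_intro[of "m - s" "{k * s..}" s E] mem_E by simp
  ultimately show ?case unfolding ideal_exps.simps step.IH by auto
qed

section \<open>The exceptional exponent\<close>

lemma h_eq: "h = a * (l * (N - 1)) + (l * (N - 1) + 1)"
proof -
  have "h = (N - 1) * (a * l) + ((N - 1) * (l - 1) + (N - 1)) + 1"
    using N_ge_3 by (simp add: h_def s_def distrib_left)
  then show ?thesis unfolding mult_pred_l by (simp add: mult_ac)
qed

lemma obtain_offsets:
  obtains n l' where "N = n + 3" "l = l' + 2"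
  using N_ge_3 l_ge_2 by (metis add.commute le_Suc_ex)

text \<open>Equivalent to \<open>(l - 1) * (N - 2)\<close> being at least 1, which
  \<open>l_ge_2\<close> and \<open>N_ge_3\<close> guarantee.\<close>

lemma a_le_h_offset: "a \<le> l * (N - 1) + 1"
  by (rule obtain_offsets) (simp add: a_eq algebra_simps)

text \<open>In \<open>h_eq\<close> the offset exceeds the index by one, so membership in
  \<open>H\<close> cannot be read off. Carrying \<open>a\<close> from the offset into the index
  cures this.\<close>

lemma h_eq_carry: "h = a * (l * (N - 1) + 1) + (l * (N - 1) + 1 - a)"
proof -
  have "a * w + (w + 1) = a * (w + 1) + (w + 1 - a)" if "a \<le> w + 1" for w
    using that by simp
  then show ?thesis using a_le_h_offset unfolding h_eq .
qed

lemma h_mem_H: "h \<in> H"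
  unfolding h_eq_carry by (rule mem_H) simp

text \<open>The index \<open>l * (N - 1) + 1\<close> of \<open>h_eq_carry\<close> equals
  \<open>(N - 2) * l + (l + 1)\<close>, so \<open>E_pow_interval\<close> applies with
  \<open>j = l + 1\<close>.\<close>

lemma h_mem_E_pow: "h \<in> E_pow (N - 2)"
proof -
  obtain n l' where n: "N = n + 3" and l: "l = l' + 2" by (rule obtain_offsets)
  have "(N - 2 - (l + 1)) * (l - 1) \<le> l * (N - 1) + 1 - a"
  proof (cases "N - 2 \<le> l + 1")
    case False
    then have "l + 1 \<le> n" using n by simp
    then obtain d where "n = l + 1 + d" by (blast dest: le_Suc_ex)
    then show ?thesis using n l by (simp add: a_eq algebra_simps)
  qed simp
  moreover have "l * (N - 1) + 1 - a \<le> (N - 2) * l + (l + 1)"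
    unfolding a_eq n by (simp add: algebra_simps)
  ultimately have "a * ((N - 2) * l + (l + 1)) + (l * (N - 1) + 1 - a) \<in> E_pow (N - 2)"
    by (rule E_pow_interval)
  moreover have "(N - 2) * l + (l + 1) = l * (N - 1) + 1"
    unfolding n by (simp add: algebra_simps)
  ultimately show ?thesis by (simp only: h_eq_carry)
qed

end

section \<open>The associated graded ring of the colon ideal\<close>

lemma nth_mult_supported:
  assumes "f \<in> supported {m..}" "g \<in> supported {n..}"
  shows "fps_nth (f * g) (m + n) = fps_nth f m * fps_nth g n"
proof -
  have "fps_nth f i * fps_nth g (m + n - i) = 0" if "i \<noteq> m" "i \<le> m + n" for i
    using that supported_nth_eq_0[OF assms(1), of i] supported_nth_eq_0[OF assms(2), of "m + n - i"]
    by (cases "i < m") auto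
  then have "fps_nth (f * g) (m + n) = (\<Sum>i=0..m + n. if i = m then fps_nth f m * fps_nth g n else 0)"
    unfolding fps_mult_nth by (intro sum.cong) auto
  then show ?thesis by simp
qed

lemma ring_of_type_algebra_simps [simp]:
  "carrier ring_of_type_algebra = (UNIV :: 'a::comm_ring_1 set)"
  "x \<otimes>\<^bsub>ring_of_type_algebra\<^esub> y = (x * y :: 'a)" "x \<oplus>\<^bsub>ring_of_type_algebra\<^esub> y = (x + y :: 'a)"
  "\<one>\<^bsub>ring_of_type_algebra\<^esub> = (1 :: 'a)" "\<zero>\<^bsub>ring_of_type_algebra\<^esub> = (0 :: 'a)"
  by (simp_all add: ring_of_type_algebra_def)

lemma domain_fps: "domain (ring_of_type_algebra :: 'k::field fps ring)"
proof (intro domain.intro domain_axioms.intro)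
  show "cring (ring_of_type_algebra :: 'k fps ring)" by (rule cring_from_type_algebra)
qed simp_all

context boundary_colon
begin

lemma ideal_pow_E: "ideal_pow A (supported E) n = supported (E_pow n)"
proof (rule ideal_pow_supported)
  show "E = H \<inter> {s..s + a} + H" unfolding E_def by (rule H_above_generated)
qed auto

lemma ideal_E: "ideal (supported E) A"
  using add_mem by (intro ideal_supported) (auto simp: E_def elim!: set_plus_elim)

sublocale gr: associated_graded A "supported E" "\<lambda>n. supported (E_pow n)"
  by (intro associated_graded.intro associated_graded_axioms.intro is_cring ideal_E
      ideal_pow_E[symmetric])

lemma supported_E_pow_subset: "supported (E_pow n) \<subseteq> supported {n * s..}"
proof (intro supported_mono subsetI)
  fix x assume "x \<in> E_pow n"
  from E_pow_gap[OF this] show "x \<in> {n * s..}" by auto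
qed

section \<open>Leading coefficients as a homomorphism to power series\<close>

lemma s_pos: "s > 0"
  using l_ge_2 by (simp add: s_def)

text \<open>The exponents of \<open>I\<^sup>n\<^sup>+\<^sup>1\<close> exceed \<open>n s\<close>, so the choice of the representative is irrelevant.\<close>

definition leading_series :: "(nat \<Rightarrow> 'k fps set) \<Rightarrow> 'k fps" where
  "leading_series g = Abs_fps (\<lambda>n. fps_nth (SOME f. f \<in> g n) (n * s))"

lemma leading_series_graded_class:
  assumes "\<And>n. p n \<in> supported (E_pow n)"
  shows "leading_series (gr.graded_class p) = Abs_fps (\<lambda>n. fps_nth (p n) (n * s))"
  unfolding leading_series_def
proof (intro arg_cong[of _ _ Abs_fps] ext)
  fix n
  define f where "f = (SOME f. f \<in> gr.graded_class p n)"
  have "p n \<in> gr.graded_class p n"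
    unfolding gr.graded_class_def a_r_coset_def' using zero_supported by force
  then have "f \<in> gr.graded_class p n" unfolding f_def by (rule someI)
  then obtain u where "u \<in> supported (E_pow (Suc n))" "f = u + p n"
    by (auto simp: gr.graded_class_def a_r_coset_def')
  moreover from this have "fps_nth u (n * s) = 0"
    using supported_E_pow_subset[of "Suc n"] s_pos by (intro supported_nth_eq_0[of u "{Suc n * s..}"]) auto
  ultimately show "fps_nth f (n * s) = fps_nth (p n) (n * s)" by simp
qed

text \<open>In degree \<open>n\<close> the order is at least \<open>n * s\<close>, so the
  coefficient there is the lowest possible one and is multiplicative; the convolution over degrees
  becomes the Cauchy product.\<close>

lemma leading_series_hom: "leading_series \<in> ring_hom gr.G ring_of_type_algebra"
proof (rule ring_hom_memI)
  have "leading_series \<one>\<^bsub>gr.G\<^esub> = 1"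
    unfolding gr.graded_class_one
    by (subst leading_series_graded_class) (auto simp: fps_eq_iff zero_mem supported_def)
  then show "leading_series \<one>\<^bsub>gr.G\<^esub> = \<one>\<^bsub>ring_of_type_algebra\<^esub>"
    by simp
  fix g g' assume "g \<in> carrier gr.G" "g' \<in> carrier gr.G"
  then obtain p p' where p: "\<And>n. p n \<in> supported (E_pow n)" "g = gr.graded_class p"
    and p': "\<And>n. p' n \<in> supported (E_pow n)" "g' = gr.graded_class p'"
    by (metis gr.graded_class_exhaust)
  have c: "p n \<in> supported H" "p' n \<in> supported H" for n
    using gr.F_carrier[OF p(1)] gr.F_carrier[OF p'(1)] by auto
  have "leading_series (g \<oplus>\<^bsub>gr.G\<^esub> g') = leading_series g + leading_series g'"
    unfolding p(2) p'(2) gr.graded_class_add[OF p(1) p'(1)]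
    using p(1) p'(1) by (subst (1 2 3) leading_series_graded_class)
      (auto simp: fps_eq_iff add_supported)
  then show "leading_series (g \<oplus>\<^bsub>gr.G\<^esub> g') =
    leading_series g \<oplus>\<^bsub>ring_of_type_algebra\<^esub> leading_series g'"
    by simp
  define r where "r = (\<lambda>n. \<Oplus>i\<in>{..n}. p i \<otimes> p' (n - i))"
  have r: "r n \<in> supported (E_pow n)" for n
    unfolding r_def
  proof (rule gr.finsum_F)
    fix i assume "i \<le> n"
    then show "p i \<otimes> p' (n - i) \<in> supported (E_pow n)"
      using gr.mult_F[OF p(1)[of i] p'(1)[of "n - i"]] by simp
  qed
  have "p i * p' j \<in> supported H" for i j
    using gr.mult_F[OF p(1)[of i] p'(1)[of j], THEN gr.F_carrier] by simp
  then have r_eq: "r n = (\<Sum>i\<le>n. p i * p' (n - i))" for n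
    unfolding r_def by (subst finsum_simp) auto
  have "fps_nth (r n) (n * s) = (\<Sum>i\<le>n. fps_nth (p i) (i * s) * fps_nth (p' (n - i)) ((n - i) * s))" for n
    unfolding r_eq fps_sum_nth
  proof (rule sum.cong)
    fix i assume "i \<in> {..n}"
    then have "n * s = i * s + (n - i) * s" by (simp flip: add_mult_distrib)
    then show "fps_nth (p i * p' (n - i)) (n * s) = fps_nth (p i) (i * s) * fps_nth (p' (n - i)) ((n - i) * s)"
      using nth_mult_supported p(1) p'(1) supported_E_pow_subset by (metis subsetD)
  qed simp
  then have "leading_series (g \<otimes>\<^bsub>gr.G\<^esub> g') = leading_series g * leading_series g'"
    unfolding p(2) p'(2) gr.graded_class_mult[OF p(1) p'(1)] r_def[symmetric]
    by (simp add: leading_series_graded_class p(1) p'(1) r fps_eq_iff fps_mult_nth atLeast0AtMost)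
  then show "leading_series (g \<otimes>\<^bsub>gr.G\<^esub> g') =
    leading_series g \<otimes>\<^bsub>ring_of_type_algebra\<^esub> leading_series g'"
    by simp
qed simp

sublocale lead: ring_hom_ring gr.G "ring_of_type_algebra :: 'k fps ring" leading_series
  using leading_series_hom gr.G.ring_axioms cring.axioms(1)[OF cring_from_type_algebra]
  by (rule ring_hom_ringI2[rotated 2])

lemma leading_series_homogeneous:
  assumes "f \<in> supported (E_pow m)"
  shows "leading_series (gr.homogeneous m f) = fps_const (fps_nth f (m * s)) * fps_X ^ m"
  unfolding gr.homogeneous_def using assms
  by (subst leading_series_graded_class) (auto simp: fps_eq_iff fps_X_power_nth)

section \<open>A strict inclusion of primes in the associated graded ring\<close>

definition leading_kernel where
  "leading_kernel = {g \<in> carrier gr.G. leading_series g = 0}"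

text \<open>The condition only concerns degree 0, where it says that a representative has no
  constant term; the components of positive degree are arbitrary.\<close>

definition graded_max_ideal where
  "graded_max_ideal = {g \<in> carrier gr.G. fps_nth (leading_series g) 0 = 0}"

lemma primeideal_leading_kernel: "primeideal leading_kernel gr.G"
  using lead.primeideal_vimage[OF gr.G.is_cring domain.zeroprimeideal[OF domain_fps]]
  by (simp add: leading_kernel_def)

text \<open>An element outside has a nonzero constant coefficient. Scaling by a constant in degree 0
  makes it \<open>- 1\<close>; adding one then lands in \<open>graded_max_ideal\<close>, so a larger
  ideal \<open>J\<close> contains one.\<close>

lemma maximalideal_graded_max_ideal: "maximalideal graded_max_ideal gr.G"
proof (rule maximalidealI)
  have "ideal {f. fps_nth f 0 = 0} (ring_of_type_algebra :: 'k fps ring)"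
  proof (rule idealI)
    show "subgroup {f. fps_nth f 0 = 0} (add_monoid (ring_of_type_algebra :: 'k fps ring))"
    proof (rule lead.S.add.subgroupI)
      fix f :: "'k fps" assume "f \<in> {f. fps_nth f 0 = 0}"
      moreover have "\<ominus>\<^bsub>ring_of_type_algebra\<^esub> f = - f"
        by (rule lead.S.minus_equality) simp_all
      ultimately show "\<ominus>\<^bsub>ring_of_type_algebra\<^esub> f \<in> {f. fps_nth f 0 = 0}"
        by simp
    qed (auto intro: exI[of _ 0])
  qed (use lead.S.ring_axioms in simp_all)
  from lead.ideal_vimage[OF this] show "ideal graded_max_ideal gr.G"
    by (simp add: graded_max_ideal_def)
  show "carrier gr.G \<noteq> graded_max_ideal"
  proof
    assume "carrier gr.G = graded_max_ideal"
    then have "\<one>\<^bsub>gr.G\<^esub> \<in> graded_max_ideal" using gr.G.one_closed by metis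
    then show False by (simp add: graded_max_ideal_def)
  qed
  fix J assume J: "ideal J gr.G" "graded_max_ideal \<subseteq> J" "J \<subseteq> carrier gr.G"
  interpret J: ideal J gr.G by (rule J(1))
  show "J = graded_max_ideal \<or> J = carrier gr.G"
  proof (rule disjCI)
    assume "J \<noteq> carrier gr.G"
    show "J = graded_max_ideal"
    proof (rule ccontr)
      assume "J \<noteq> graded_max_ideal"
      then obtain x where x: "x \<in> J" "x \<in> carrier gr.G" "fps_nth (leading_series x) 0 \<noteq> 0"
        using J by (auto simp: graded_max_ideal_def)
      define c where "c = fps_const (- inverse (fps_nth (leading_series x) 0))"
      have c: "c \<in> supported (E_pow 0)" by (simp add: c_def const_supported zero_mem)
      then have cG: "gr.homogeneous 0 c \<in> carrier gr.G" by (rule gr.homogeneous_closed)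
      define u where "u = gr.homogeneous 0 c \<otimes>\<^bsub>gr.G\<^esub> x"
      have u: "u \<in> J" "u \<in> carrier gr.G"
        using x J.I_l_closed[OF x(1) cG] cG by (simp_all add: u_def)
      have "fps_nth (leading_series u) 0 = - 1"
        using x cG leading_series_homogeneous[OF c] by (simp add: u_def c_def)
      then have "\<one>\<^bsub>gr.G\<^esub> \<oplus>\<^bsub>gr.G\<^esub> u \<in> graded_max_ideal"
        using u by (simp add: graded_max_ideal_def)
      then have "(\<one>\<^bsub>gr.G\<^esub> \<oplus>\<^bsub>gr.G\<^esub> u) \<ominus>\<^bsub>gr.G\<^esub> u \<in> J"
        using u(1) J(2) by (auto simp: a_minus_def)
      moreover have "(\<one>\<^bsub>gr.G\<^esub> \<oplus>\<^bsub>gr.G\<^esub> u) \<ominus>\<^bsub>gr.G\<^esub> u = \<one>\<^bsub>gr.G\<^esub>"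
        using u(2) by (simp add: a_minus_def gr.G.a_assoc gr.G.r_neg)
      ultimately show False using J.one_imp_carrier \<open>J \<noteq> carrier gr.G\<close> by simp
    qed
  qed
qed

text \<open>The class of \<open>fps_X ^ s\<close> in degree 1 has leading series
  \<open>fps_X\<close> and separates the two.\<close>

lemma leading_kernel_psubset: "leading_kernel \<subset> graded_max_ideal"
proof
  show "leading_kernel \<subseteq> graded_max_ideal"
    by (auto simp: leading_kernel_def graded_max_ideal_def)
  have "s \<in> E_pow 1" using mem_E(1) zero_mem set_plus_intro[of 0 H s E] by simp
  then have X: "fps_X ^ s \<in> (supported (E_pow 1) :: 'k fps set)" by simp
  let ?z = "gr.homogeneous 1 (fps_X ^ s)"
  have "leading_series ?z = fps_X"
    using leading_series_homogeneous[OF X] by (simp add: fps_X_power_nth)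
  then have "?z \<in> graded_max_ideal" "?z \<notin> leading_kernel"
    using gr.homogeneous_closed[OF X] by (simp_all add: leading_kernel_def graded_max_ideal_def)
  then show "leading_kernel \<noteq> graded_max_ideal" by blast
qed

text \<open>
  In degree \<open>0\<close> this holds since \<open>h\<close> plus a positive number is an exponent of \<open>I\<^sup>N\<^sup>-\<^sup>1\<close>; in degree
  \<open>n > 0\<close> since \<open>I\<^sup>n\<^sup>+\<^sup>N\<^sup>-\<^sup>1\<close> contains everything of order at least \<open>(n + N - 1) s\<close>.
\<close>

lemma graded_max_ideal_mult_socle:
  assumes "g \<in> graded_max_ideal"
  shows "g \<otimes>\<^bsub>gr.G\<^esub> gr.homogeneous (N - 2) (fps_X ^ h) = \<zero>\<^bsub>gr.G\<^esub>"
proof -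
  have "g \<in> carrier gr.G" using assms by (simp add: graded_max_ideal_def)
  then obtain p where p: "\<And>n. p n \<in> supported (E_pow n)" "g = gr.graded_class p"
    using gr.graded_class_exhaust by blast
  have p0: "fps_nth (p 0) 0 = 0"
    using assms leading_series_graded_class[OF p(1)] by (simp add: graded_max_ideal_def p(2))
  have "p n * fps_X ^ h \<in> supported (E_pow (Suc (n + (N - 2))))" for n
    unfolding supported_def
  proof clarify
    fix i assume i: "fps_nth (p n * fps_X ^ h) i \<noteq> 0"
    then have nz: "fps_nth (p n) (i - h) \<noteq> 0" and "h \<le> i"
      by (auto simp: fps_X_power_mult_right_nth split: if_splits)
    have eq: "Suc (n + (N - 2)) = n + (N - 1)" using N_ge_3 by simp
    show "i \<in> E_pow (Suc (n + (N - 2)))"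
    proof (cases "n = 0")
      case True
      then have "i \<noteq> h" using nz p0 by (cases "i = h") auto
      then show ?thesis unfolding eq using True \<open>h \<le> i\<close> E_pow_pred by (simp add: h_def)
    next
      case False
      have "n * s \<le> i - h"
        using supportedD[OF subsetD[OF supported_E_pow_subset p(1)] nz] by simp
      then have "(n + (N - 1)) * s \<le> i" using \<open>h \<le> i\<close> by (simp add: h_def add_mult_distrib)
      then show ?thesis unfolding eq using False E_pow_stable[of "n + (N - 1)"] by simp
    qed
  qed
  then show ?thesis
    unfolding p(2) using h_mem_E_pow by (intro gr.mult_homogeneous_eq_zero p(1)) simp_all
qed

lemma not_cohen_macaulay: "\<not> cohen_macaulay gr.G"
proof
  assume "cohen_macaulay gr.G"
  then have eq: "ideal_depth gr.G graded_max_ideal = ideal_height gr.G graded_max_ideal"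
    using maximalideal_graded_max_ideal unfolding cohen_macaulay_def by blast
  have X: "fps_X ^ h \<in> (supported (E_pow (N - 2)) :: 'k fps set)" using h_mem_E_pow by simp
  have "Suc (N - 2) = N - 1" using N_ge_3 by simp
  \<comment> \<open>The class is nonzero because \<open>h\<close> is the exponent missing from
    \<open>E_pow (N - 1)\<close>.\<close>
  then have "gr.homogeneous (N - 2) (fps_X ^ h) \<noteq> \<zero>\<^bsub>gr.G\<^esub>"
    using gr.homogeneous_eq_zero_iff[OF X] E_pow_pred by (simp del: ideal_exps.simps)
  then have "ideal_depth gr.G graded_max_ideal = 0"
    using graded_max_ideal_mult_socle gr.homogeneous_closed[OF X]
    by (intro gr.G.ideal_depth_eq_0) (auto simp: graded_max_ideal_def)
  moreover have "1 \<le> ideal_height gr.G graded_max_ideal"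
    using gr.G.maximalideal_prime[OF maximalideal_graded_max_ideal]
    by (rule ideal_height_pos[OF primeideal_leading_kernel _ leading_kernel_psubset])
  ultimately show False using eq by simp
qed

section \<open>The intersection and the reduction number\<close>

abbreviation param_ideal where "param_ideal \<equiv> Idl {fps_X ^ s}"

lemma param_ideal_mult_pow:
  "param_ideal \<cdot> ideal_pow A (supported E) n = supported ({s} + E_pow n)"
proof -
  have cl: "E_pow n + H \<subseteq> E_pow n"
    using add_mem by (intro ideal_exps_closed) (auto simp: E_def elim!: set_plus_elim)
  have "supported ({s} + H) \<cdot> supported (E_pow n) = supported ({s} + H + E_pow n)"
    by (rule ideal_prod_supported[OF refl _ cl]) simp
  moreover have "H + E_pow n = E_pow n"
  proof
    show "H + E_pow n \<subseteq> E_pow n" using cl by (simp add: add.commute)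
    show "E_pow n \<subseteq> H + E_pow n" using set_zero_plus2[OF zero_mem] .
  qed
  ultimately show ?thesis
    by (simp only: genideal_X_power[OF s_mem_H] ideal_pow_E add.assoc)
qed

lemma h_notin: "s + h \<notin> {s} + E_pow (N - 1)"
  using E_pow_pred by (simp add: set_plus_def)

lemma intersection_ne:
  "param_ideal \<inter> ideal_pow A (supported E) N \<noteq> param_ideal \<cdot> ideal_pow A (supported E) (N - 1)"
proof -
  have N: "N = Suc (N - 1)" using N_ge_3 by simp
  then have "N * s = s + (N - 1) * s" by (metis mult_Suc)
  then have "s + h \<in> E_pow N" using E_pow_stable[of N] by (simp add: h_def)
  moreover have "s + h \<in> {s} + H" using h_mem_H by blast
  ultimately have "fps_X ^ (s + h) \<in> param_ideal \<inter> ideal_pow A (supported E) N"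
    by (simp only: genideal_X_power[OF s_mem_H] ideal_pow_E Int_iff X_power_supported_iff)
  moreover have "fps_X ^ (s + h) \<notin> param_ideal \<cdot> ideal_pow A (supported E) (N - 1)"
    using h_notin by (simp only: param_ideal_mult_pow X_power_supported_iff not_False_eq_True)
  ultimately show ?thesis by blast
qed

lemma pow_eq_iff: "ideal_pow A (supported E) (n + 1) = param_ideal \<cdot> ideal_pow A (supported E) n
  \<longleftrightarrow> E_pow (Suc n) = {s} + E_pow n"
proof -
  have "ideal_pow A (supported E) (n + 1) = supported (E_pow (Suc n))"
    unfolding ideal_pow_E by simp
  then show ?thesis unfolding param_ideal_mult_pow using supported_eqD by metis
qed

text \<open>Once the equality holds for some \<open>n\<close>, adding \<open>E\<close> to both sides
  carries it to \<open>Suc n\<close>. If it held below \<open>N\<close>, it would therefore hold at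
  \<open>N - 1\<close>, where \<open>s + h\<close> refutes it.\<close>

lemma reduction_number_eq: "reduction_number A param_ideal (supported E) = enat N"
proof -
  have stable: "E_pow (Suc n) = {s} + E_pow n" if "N \<le> n" for n
  proof -
    have "{Suc n * s..} = {s} + {n * s..}"
    proof (intro equalityI subsetI)
      fix m assume "m \<in> {Suc n * s..}"
      then have "m = s + (m - s)" "m - s \<in> {n * s..}" by auto
      then show "m \<in> {s} + {n * s..}" by (metis set_plus_intro singletonI)
    qed (auto elim!: set_plus_elim)
    then show ?thesis using that E_pow_stable[of n] E_pow_stable[of "Suc n"] by simp
  qed
  have step: "E_pow (Suc (Suc n)) = {s} + E_pow (Suc n)" if "E_pow (Suc n) = {s} + E_pow n" for n
    using arg_cong[OF that, of "\<lambda>S. S + E"] by (simp add: add.assoc)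
  have "N \<le> n" if "E_pow (Suc n) = {s} + E_pow n" for n
  proof (rule ccontr)
    assume "\<not> N \<le> n"
    then have "n \<le> N - 1" by simp
    then have "E_pow (Suc (N - 1)) = {s} + E_pow (N - 1)"
      by (induction rule: dec_induct) (use that step in blast)+
    moreover have "Suc (N - 1) = N" using N_ge_3 by simp
    moreover have "s + h \<in> E_pow N"
    proof -
      have "N * s = s + (N - 1) * s" using \<open>Suc (N - 1) = N\<close> by (metis mult_Suc)
      then show ?thesis using E_pow_stable[of N] by (simp add: h_def)
    qed
    ultimately show False using h_notin by simp
  qed
  then have iff: "E_pow (Suc n) = {s} + E_pow n \<longleftrightarrow> N \<le> n" for n using stable by blast
  have "{enat n | n. ideal_pow A (supported E) (n + 1) = param_ideal \<cdot> ideal_pow A (supported E) n}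
    = {enat n | n. N \<le> n}"
    unfolding pow_eq_iff iff ..
  moreover have "Inf {enat n | n. N \<le> n} = enat N"
    by (intro antisym Inf_lower Inf_greatest) auto
  ultimately show ?thesis unfolding reduction_number_def by simp
qed

end

theorem theorem3p8:
  fixes a q s l r :: nat and H :: "nat set"
    and A :: "'k::field fps ring" and \<mm> Q I :: "'k fps set"
  assumes "a \<ge> 2"
    and "H = {\<alpha> * a + \<beta> * (a + 1) | \<alpha> \<beta>. True}"
    and "A = semigroup_ring H"
    and "\<mm> = Idl\<^bsub>A\<^esub> {fps_X ^ a, fps_X ^ (a + 1)}"
    and "q = a - 1"
    and "s \<in> H" "0 < s" "s < a * q"
    and "Q = Idl\<^bsub>A\<^esub> {fps_X ^ s}"
    and "I = colon_ideal A Q (ideal_pow A \<mm> q)"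
    and "s = a * l + r" "1 \<le> l" "l < q" "r < a"
    and "r = l - 1"
    and "l \<ge> 2" "a \<ge> l + 3"
  shows "Q \<inter> ideal_pow A I (a - l) \<noteq> Q \<cdot>\<^bsub>A\<^esub> ideal_pow A I ((a - l) - 1)
    \<and> \<not> cohen_macaulay (assoc_graded A I)
    \<and> reduction_number A Q I = enat (a - l)"
proof -
  interpret boundary_colon a H A l "a - l" s "(a - l - 1) * s + (a - l)" "H \<inter> {s..}"
    using assms(1-3,11,15-17) by unfold_locales auto
  have "I = supported (H \<inter> {s..})"
    using colon_conductor[OF s_mem_H s_less_conductor] assms(4,5,9,10) by simp
  then show ?thesis
    using intersection_ne not_cohen_macaulay reduction_number_eq assms(9) by simp
qed

end
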